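(* Let $p_1,\ldots,p_r$ be points of the hyperplane $\mathbb{P}^{d-1}=\{x_0=0\}\subset\mathbb{P}^d$, let $m_1,\ldots,m_r$ be nonnegative integers, and let $Z'=m_1p_1+\cdots+m_rp_r\subset\mathbb{P}^d$. Let $F'_\bullet$ be the complex of graded free $R'$-modules, with differentials $\phi'_j$ ($j\ge1$) and augmentation $\phi'_0$, constructed in the context. Then $F'_\bullet$ is a resolution of $I(Z')$ over $R'$; that is, the image of $\phi'_0$ is $I(Z')$ and, for all $j\ge1$, the image of $\phi'_j$ is the kernel of $\phi'_{j-1}$.
   Context: $K$ is an algebraically closed field of arbitrary characteristic, $R=K[\mathbb{P}^{d-1}]=K[x_1,\ldots,x_d]\subset R'=K[\mathbb{P}^d]=K[x_0,x_1,\ldots,x_d]$ with the standard gradings, and $\mathbb{P}^{d-1}$ is regarded as the hyperplane $x_0=0$ of $\mathbb{P}^d$. For an integer $n$, $n_+=\max\{n,0\}$. Fat points: for points $p_j\in\mathbb{P}^n$ and nonnegative integers $a_j$, the fat point subscheme $W=a_1p_1+\cdots+a_rp_r\subset\mathbb{P}^n$ has ideal $I(W)=\bigcap_jI_j^{a_j}\subset K[\mathbb{P}^n]$, where $I_j$ is the ideal generated by all forms vanishing at $p_j$ (and $I_j^0=(1)$). Let $m=\max\{m_1,\ldots,m_r\}$ and, for $0\le i\le m$, $Z_i=(m_1-m+i)_+p_1+\cdots+(m_r-m+i)_+p_r\subset\mathbb{P}^{d-1}$, so $I(Z_i)\subset R$, $Z_0=\emptyset$, $I(Z_0)=R$ and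 $I(Z_{i+1})\subset I(Z_i)$. Construction. For each $0\le i\le m$ fix a graded minimal free resolution $F_{i,\bullet}$ of $I(Z_i)$ over $R$, with differentials $\phi_{i,j+1}:F_{i,j+1}\to F_{i,j}$ ($j\ge0$) and augmentation $\phi_{i,0}:F_{i,0}\to I(Z_i)$; $s_{k,i,j}$ (indexed by $k$) denotes the free homogeneous generators of $F_{i,j}$. (So $F_{0,0}=R$ and $F_{0,j}=0$ for $j\ge1$.) For $0\le i<m$ let $f_{i+1,j}:F_{i+1,j}\to F_{i,j}$, $j\ge0$, be $R$-homomorphisms homogeneous of degree $0$ lifting the inclusion $I(Z_{i+1})\subset I(Z_i)$, i.e. $f_{i+1,j}\phi_{i+1,j+1}=\phi_{i,j+1}f_{i+1,j+1}$ for $j\ge0$ and $\phi_{i+1,0}=\phi_{i,0}f_{i+1,0}$. Put $F'_{i,j}=F_{i,j}(-(m-i))\otimes_RR'$; let $\phi'_{i,j}$ be the map $\phi_{i,j}\otimes_R\mathrm{id}_{R'}$ (defined on $F'_{i,j}$, with values in $F'_{i,j-1}$ for $j\ge1$, and in $R'$ for $j=0$, ignoring shifts), and let $f'_{i+1,j}:F'_{i+1,j}(-1)\to F'_{i,j}$ be the map $f_{i+1,j}\otimes_R\mathrm{id}_{R'}$. Define $$F'_0=\bigoplus_{i=0}^mF'_{i,0},\qquad F'_j=F'_{0,j}\oplus\bigoplus_{i=1}^m\left(F'_{i,j}\oplus F'_{i,j-1}(-1)\right)\quad(j\ge1),$$ with $R'$-linear maps $\phi'_0:F'_0\to R'$ and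 $\phi'_j:F'_j\to F'_{j-1}$ ($j\ge1$) given on generators by: - $\phi'_0(s_{k,i,0}\otimes1)=\phi'_{i,0}(s_{k,i,0}\otimes x_0^{m-i})=x_0^{m-i}\phi_{i,0}(s_{k,i,0})$ for $s_{k,i,0}\otimes1\in F'_{i,0}$, $0\le i\le m$; - for $j\ge1$ and $s_{k,i,j}\otimes1$ in the summand $F'_{i,j}$ of $F'_j$: $\phi'_j(s_{k,i,j}\otimes1)=\phi'_{i,j}(s_{k,i,j}\otimes1)\in F'_{i,j-1}$; - for $s_{k,i,0}\otimes1$ in the summand $F'_{i,0}(-1)$ of $F'_1$, $1\le i\le m$: $\phi'_1(s_{k,i,0}\otimes1)=s_{k,i,0}\otimes x_0-f'_{i,0}(s_{k,i,0}\otimes1)$, where the first term is in $F'_{i,0}$ and the second in $F'_{i-1,0}$; - for $j\ge1$ and $s_{k,i,j}\otimes1$ in the summand $F'_{i,j}(-1)$ of $F'_{j+1}$, $1\le i\le m$: $\phi'_{j+1}(s_{k,i,j}\otimes1)=s_{k,i,j}\otimes x_0-f'_{i,j}(s_{k,i,j}\otimes1)-\phi'_{i,j}(s_{k,i,j}\otimes1)$, where the three terms lie in the summands $F'_{i,j}$, $F'_{i-1,j}$ and $F'_{i,j-1}(-1)$ of $F'_j$ respectively. *)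

theory Defs
  imports
    "HOL-Library.Poly_Mapping"
    "HOL-Computational_Algebra.Polynomial"
    "HOL-Algebra.Ideal_Product"
begin

section \<open>Polynomial rings in a set of variables\<close>

text \<open>
  Polynomials have variables indexed by \<open>nat\<close>, and \<open>polys A\<close> consists of those involving only
  the variables with index in \<open>A\<close>.  So \<open>R = K[x\<^sub>1,\<dots>,x\<^sub>d]\<close> is \<open>polys {1..d}\<close>,
  \<open>R' = K[x\<^sub>0,\<dots>,x\<^sub>d]\<close> is \<open>polys {0..d}\<close>, and the inclusion of \<open>R\<close> in \<open>R'\<close> is a literal one.
\<close>

type_synonym 'k mpoly = "(nat \<Rightarrow>\<^sub>0 nat) \<Rightarrow>\<^sub>0 'k"

definition Var :: "nat \<Rightarrow> 'k::comm_ring_1 mpoly"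
  where "Var i = Poly_Mapping.single (Poly_Mapping.single i 1) 1"

definition polys :: "nat set \<Rightarrow> 'k::comm_ring_1 mpoly set"
  where "polys A = {q. \<forall>\<mu>\<in>Poly_Mapping.keys q. Poly_Mapping.keys \<mu> \<subseteq> A}"

definition poly_ring :: "nat set \<Rightarrow> 'k::comm_ring_1 mpoly ring"
  where "poly_ring A = \<lparr>carrier = polys A, mult = (*), one = 1, zero = 0, add = (+)\<rparr>"

definition mdeg :: "(nat \<Rightarrow>\<^sub>0 nat) \<Rightarrow> nat"
  where "mdeg \<mu> = (\<Sum>i\<in>Poly_Mapping.keys \<mu>. Poly_Mapping.lookup \<mu> i)"

text \<open>The degree is an integer so that shifted gradings make sense; zero is homogeneous of
  every degree, and is the only homogeneous polynomial of negative degree.\<close>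

definition homog :: "int \<Rightarrow> 'k::comm_ring_1 mpoly \<Rightarrow> bool"
  where "homog n q \<longleftrightarrow> (\<forall>\<mu>\<in>Poly_Mapping.keys q. int (mdeg \<mu>) = n)"

definition mpoly_eval :: "(nat \<Rightarrow> 'k::comm_ring_1) \<Rightarrow> 'k mpoly \<Rightarrow> 'k"
  where "mpoly_eval v q =
    (\<Sum>\<mu>\<in>Poly_Mapping.keys q. Poly_Mapping.lookup q \<mu> *
       (\<Prod>i\<in>Poly_Mapping.keys \<mu>. v i ^ Poly_Mapping.lookup \<mu> i))"


section \<open>Projective space and fat points\<close>

text \<open>
  A point of the projective space with homogeneous coordinates indexed by \<open>A\<close> is the set of all its
  homogeneous coordinate vectors, where a vector is extended by zero to all indices.  With this
  convention the hyperplane \<open>x\<^sub>0 = 0\<close> of \<open>proj_space {0..d}\<close> is \<open>proj_space {1..d}\<close> itself.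
\<close>

definition proj_space :: "nat set \<Rightarrow> (nat \<Rightarrow> 'k::field) set set"
  where "proj_space A =
    {P. \<exists>v. (\<forall>i. i \<notin> A \<longrightarrow> v i = 0) \<and> (\<exists>i. v i \<noteq> 0) \<and> P = {\<lambda>i. c * v i | c. c \<noteq> 0}}"

definition point_ideal :: "nat set \<Rightarrow> (nat \<Rightarrow> 'k::field) set \<Rightarrow> 'k mpoly set"
  where "point_ideal A P =
    Idl\<^bsub>poly_ring A\<^esub> {q \<in> polys A. (\<exists>n. homog n q) \<and> (\<forall>v\<in>P. mpoly_eval v q = 0)}"

text \<open>The ideal of the fat point subscheme \<open>a 1 p\<^sub>1 + \<dots> + a r p\<^sub>r\<close>.  The power is the one in the
  multiplicative monoid of ideals, so the zeroth power is the whole ring.\<close>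

definition fat_ideal ::
    "nat set \<Rightarrow> nat \<Rightarrow> (nat \<Rightarrow> (nat \<Rightarrow> 'k::field) set) \<Rightarrow> (nat \<Rightarrow> nat) \<Rightarrow> 'k mpoly set"
  where "fat_ideal A r p a =
    polys A \<inter> (\<Inter>j\<in>{1..r}. point_ideal A (p j) [^]\<^bsub>ideals_set (poly_ring A)\<^esub> a j)"


section \<open>Graded free resolutions\<close>

text \<open>
  An element of the free module over \<open>polys A\<close> on the finite set \<open>G\<close> is its coordinate function,
  zero outside \<open>G\<close>.  A homomorphism out of this module is given by the images of the generators;
  \<open>lin_ext\<close> (for a free module as target) and \<open>lin_form\<close> (for the ring as target) are the resulting
  maps.  As \<open>R\<close> is contained in \<open>R'\<close>, the same images of generators also describe the homomorphism
  after base change from \<open>R\<close> to \<open>R'\<close>.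
\<close>

definition free_mod :: "nat set \<Rightarrow> 'g set \<Rightarrow> ('g \<Rightarrow> 'k::comm_ring_1 mpoly) set"
  where "free_mod A G = {v. (\<forall>g\<in>G. v g \<in> polys A) \<and> (\<forall>g. g \<notin> G \<longrightarrow> v g = 0)}"

definition lin_ext ::
    "'g set \<Rightarrow> ('g \<Rightarrow> 'h \<Rightarrow> 'k::comm_ring_1 mpoly) \<Rightarrow> ('g \<Rightarrow> 'k mpoly) \<Rightarrow> 'h \<Rightarrow> 'k mpoly"
  where "lin_ext G \<phi> v = (\<lambda>h. \<Sum>g\<in>G. v g * \<phi> g h)"

definition lin_form :: "'g set \<Rightarrow> ('g \<Rightarrow> 'k::comm_ring_1 mpoly) \<Rightarrow> ('g \<Rightarrow> 'k mpoly) \<Rightarrow> 'k mpoly"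
  where "lin_form G \<epsilon> v = (\<Sum>g\<in>G. v g * \<epsilon> g)"

text \<open>Homogeneous elements of degree \<open>n\<close>, where the generator \<open>g\<close> has degree \<open>deg g\<close>.\<close>

definition homog_elem ::
    "nat set \<Rightarrow> 'g set \<Rightarrow> ('g \<Rightarrow> int) \<Rightarrow> int \<Rightarrow> ('g \<Rightarrow> 'k::comm_ring_1 mpoly) \<Rightarrow> bool"
  where "homog_elem A G deg n v \<longleftrightarrow> v \<in> free_mod A G \<and> (\<forall>g\<in>G. homog (n - deg g) (v g))"

text \<open>
  An augmented complex of graded free modules: \<open>gens C j\<close> is the set of free generators in
  homological degree \<open>j\<close>, \<open>gdeg C j\<close> their degrees, \<open>aug C\<close> the augmentation on the generators in
  homological degree \<open>0\<close>, and \<open>bdry C j\<close>, for \<open>j \<ge> 1\<close>, the differential from homological degree \<open>j\<close>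
  to \<open>j - 1\<close>.  The value of \<open>bdry C 0\<close> is irrelevant.
\<close>

record ('g, 'a) gcomplex =
  gens :: "nat \<Rightarrow> 'g set"
  gdeg :: "nat \<Rightarrow> 'g \<Rightarrow> int"
  aug :: "'g \<Rightarrow> 'a"
  bdry :: "nat \<Rightarrow> 'g \<Rightarrow> 'g \<Rightarrow> 'a"

definition chains :: "nat set \<Rightarrow> ('g, 'k::comm_ring_1 mpoly) gcomplex \<Rightarrow> nat \<Rightarrow> ('g \<Rightarrow> 'k mpoly) set"
  where "chains A C j = free_mod A (gens C j)"

definition aug_map :: "('g, 'k::comm_ring_1 mpoly) gcomplex \<Rightarrow> ('g \<Rightarrow> 'k mpoly) \<Rightarrow> 'k mpoly"
  where "aug_map C = lin_form (gens C 0) (aug C)"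

definition bdry_map ::
    "('g, 'k::comm_ring_1 mpoly) gcomplex \<Rightarrow> nat \<Rightarrow> ('g \<Rightarrow> 'k mpoly) \<Rightarrow> 'g \<Rightarrow> 'k mpoly"
  where "bdry_map C j = lin_ext (gens C j) (bdry C j)"

text \<open>Finite rank, and all maps homogeneous of degree \<open>0\<close>.\<close>

definition graded_free :: "nat set \<Rightarrow> ('g, 'k::comm_ring_1 mpoly) gcomplex \<Rightarrow> bool"
  where "graded_free A C \<longleftrightarrow>
    (\<forall>j. finite (gens C j)) \<and>
    (\<forall>g\<in>gens C 0. aug C g \<in> polys A \<and> homog (gdeg C 0 g) (aug C g)) \<and>
    (\<forall>j. \<forall>g\<in>gens C (Suc j).
       homog_elem A (gens C j) (gdeg C j) (gdeg C (Suc j) g) (bdry C (Suc j) g))"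

definition graded_free_resolution ::
    "nat set \<Rightarrow> ('g, 'k::comm_ring_1 mpoly) gcomplex \<Rightarrow> 'k mpoly set \<Rightarrow> bool"
  where "graded_free_resolution A C I \<longleftrightarrow>
    graded_free A C \<and>
    aug_map C ` chains A C 0 = I \<and>
    bdry_map C 1 ` chains A C 1 = {v \<in> chains A C 0. aug_map C v = 0} \<and>
    (\<forall>j\<ge>2. bdry_map C j ` chains A C j =
       {v \<in> chains A C (j - 1). bdry_map C (j - 1) v = (\<lambda>_. 0)})"

definition irrelevant_ideal :: "nat set \<Rightarrow> 'k::comm_ring_1 mpoly set"
  where "irrelevant_ideal A = Idl\<^bsub>poly_ring A\<^esub> (Var ` A)"

definition minimal_graded_free_resolution ::
    "nat set \<Rightarrow> ('g, 'k::comm_ring_1 mpoly) gcomplex \<Rightarrow> 'k mpoly set \<Rightarrow> bool"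
  where "minimal_graded_free_resolution A C I \<longleftrightarrow>
    graded_free_resolution A C I \<and>
    (\<forall>j\<ge>1. \<forall>v\<in>chains A C j. \<forall>h\<in>gens C (j - 1). bdry_map C j v h \<in> irrelevant_ideal A)"

text \<open>\<open>f j\<close> are homomorphisms of degree \<open>0\<close> from \<open>C\<close> to \<open>D\<close> lifting an inclusion of the
  augmentation ideals.\<close>

definition lifts_inclusion ::
    "nat set \<Rightarrow> ('g, 'k::comm_ring_1 mpoly) gcomplex \<Rightarrow> ('g, 'k mpoly) gcomplex
      \<Rightarrow> (nat \<Rightarrow> 'g \<Rightarrow> 'g \<Rightarrow> 'k mpoly) \<Rightarrow> bool"
  where "lifts_inclusion A C D f \<longleftrightarrow>
    (\<forall>j. \<forall>g\<in>gens C j. homog_elem A (gens D j) (gdeg D j) (gdeg C j g) (f j g)) \<and>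
    (\<forall>j. \<forall>v\<in>chains A C (Suc j).
       lin_ext (gens C j) (f j) (bdry_map C (Suc j) v) =
       bdry_map D (Suc j) (lin_ext (gens C (Suc j)) (f (Suc j)) v)) \<and>
    (\<forall>v\<in>chains A C 0. aug_map C v = aug_map D (lin_ext (gens C 0) (f 0) v))"


section \<open>The complex \<open>F'\<close>\<close>

text \<open>
  The generators of \<open>F'\<^sub>j\<close> are \<open>Plain i g\<close>, for \<open>g\<close> a generator of the summand \<open>F'\<^sub>i\<^sub>,\<^sub>j\<close>, and
  \<open>Shift i g\<close>, for \<open>g\<close> a generator of the summand \<open>F'\<^sub>i\<^sub>,\<^sub>j\<^sub>-\<^sub>1(-1)\<close>; the latter only
  occurs for \<open>i \<ge> 1\<close> and \<open>j \<ge> 1\<close>.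
\<close>

datatype 'g tgen = Plain nat 'g | Shift nat 'g

definition in_Plain :: "nat \<Rightarrow> ('g \<Rightarrow> 'k::comm_ring_1 mpoly) \<Rightarrow> 'g tgen \<Rightarrow> 'k mpoly"
  where "in_Plain i v t =
    (case t of Plain i' g \<Rightarrow> if i' = i then v g else 0 | Shift i' g \<Rightarrow> 0)"

definition in_Shift :: "nat \<Rightarrow> ('g \<Rightarrow> 'k::comm_ring_1 mpoly) \<Rightarrow> 'g tgen \<Rightarrow> 'k mpoly"
  where "in_Shift i v t =
    (case t of Plain i' g \<Rightarrow> 0 | Shift i' g \<Rightarrow> if i' = i then v g else 0)"

text \<open>\<open>F i\<close> is the resolution \<open>F\<^sub>i\<close> and \<open>f i j\<close> the homomorphism from \<open>F\<^sub>i\<^sub>,\<^sub>j\<close> to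
  \<open>F\<^sub>i\<^sub>-\<^sub>1\<^sub>,\<^sub>j\<close>, used for \<open>1 \<le> i \<le> m\<close>.  In \<open>tot_bdry\<close>, the function
  \<open>\<lambda>h. if h = g then Var 0 else 0\<close> is \<open>x\<^sub>0\<close> times the generator \<open>g\<close>.\<close>

definition tot_gens :: "nat \<Rightarrow> (nat \<Rightarrow> ('g, 'a) gcomplex) \<Rightarrow> nat \<Rightarrow> 'g tgen set"
  where "tot_gens m F j =
    {Plain i g | i g. i \<le> m \<and> g \<in> gens (F i) j} \<union>
    {Shift i g | i g. 1 \<le> j \<and> 1 \<le> i \<and> i \<le> m \<and> g \<in> gens (F i) (j - 1)}"

definition tot_deg :: "nat \<Rightarrow> (nat \<Rightarrow> ('g, 'a) gcomplex) \<Rightarrow> nat \<Rightarrow> 'g tgen \<Rightarrow> int"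
  where "tot_deg m F j t =
    (case t of
       Plain i g \<Rightarrow> gdeg (F i) j g + (int m - int i)
     | Shift i g \<Rightarrow> gdeg (F i) (j - 1) g + (int m - int i) + 1)"

definition tot_aug :: "nat \<Rightarrow> (nat \<Rightarrow> ('g, 'k::comm_ring_1 mpoly) gcomplex) \<Rightarrow> 'g tgen \<Rightarrow> 'k mpoly"
  where "tot_aug m F t =
    (case t of Plain i g \<Rightarrow> Var 0 ^ (m - i) * aug (F i) g | Shift i g \<Rightarrow> 0)"

definition tot_bdry ::
    "(nat \<Rightarrow> ('g, 'k::comm_ring_1 mpoly) gcomplex) \<Rightarrow> (nat \<Rightarrow> nat \<Rightarrow> 'g \<Rightarrow> 'g \<Rightarrow> 'k mpoly)
      \<Rightarrow> nat \<Rightarrow> 'g tgen \<Rightarrow> 'g tgen \<Rightarrow> 'k mpoly"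
  where "tot_bdry F f j t =
    (case t of
       Plain i g \<Rightarrow> in_Plain i (bdry (F i) j g)
     | Shift i g \<Rightarrow> (\<lambda>u.
           in_Plain i (\<lambda>h. if h = g then Var 0 else 0) u
         - in_Plain (i - 1) (f i (j - 1) g) u
         - (if j = 1 then 0 else in_Shift i (bdry (F i) (j - 1) g) u)))"

definition tot_complex ::
    "nat \<Rightarrow> (nat \<Rightarrow> ('g, 'k::comm_ring_1 mpoly) gcomplex) \<Rightarrow> (nat \<Rightarrow> nat \<Rightarrow> 'g \<Rightarrow> 'g \<Rightarrow> 'k mpoly)
      \<Rightarrow> ('g tgen, 'k mpoly) gcomplex"
  where "tot_complex m F f =
    \<lparr>gens = tot_gens m F, gdeg = tot_deg m F, aug = tot_aug m F, bdry = tot_bdry F f\<rparr>"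

end

theory Submission
  imports Defs
begin

text \<open>
  Write \<open>R = K[x\<^sub>1,\<dots>,x\<^sub>d]\<close> and \<open>R' = R[x\<^sub>0]\<close>.  Everything is read off coefficients with respect to
  \<open>x\<^sub>0\<close>: an element of \<open>R'\<close> is a unique finite sum of terms \<open>x\<^sub>0\<^sup>k q\<^sub>k\<close> with \<open>q\<^sub>k\<close> in \<open>R\<close>, and taking
  \<open>q\<^sub>k\<close> is \<open>R\<close>-linear.

  The ideal.  A form of \<open>R'\<close> vanishes at a point of the hyperplane \<open>x\<^sub>0 = 0\<close> iff its coefficient
  \<open>q\<^sub>0\<close> does, so the ideal of such a point in \<open>R'\<close> is generated by \<open>x\<^sub>0\<close> and its ideal \<open>J\<close> in \<open>R\<close>.
  Hence the \<open>n\<close>-th power of that ideal consists of the \<open>q\<close> with \<open>q\<^sub>k\<close> in \<open>J\<close> to the power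
  \<open>(n - k)\<^sub>+\<close> for all \<open>k\<close> (\<open>point_ideal_power_insert_0\<close>).  Intersecting over the points, \<open>I(Z')\<close>
  consists of the \<open>q\<close> with \<open>q\<^sub>k \<in> I(Z\<^bsub>m-k\<^esub>)\<close> for \<open>k \<le> m\<close> and \<open>q\<^sub>k\<close> arbitrary for \<open>k > m\<close>
  (\<open>fat_ideal_insert_0\<close>).  As the ideals \<open>I(Z\<^sub>i)\<close> decrease with \<open>i\<close>, this is the sum of
  the ideals \<open>x\<^sub>0\<^bsup>m-i\<^esup> I(Z\<^sub>i) R'\<close> (\<open>sum_of_x0_shifts_eq_x0_graded\<close>), which is the image of the
  augmentation of \<open>F'\<close>.

  The complex.  Since \<open>R'\<close> is free over \<open>R\<close> on the powers of \<open>x\<^sub>0\<close>, the complexes \<open>F\<^sub>i \<otimes> R'\<close> resolve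
  the ideals \<open>I(Z\<^sub>i) R'\<close> (\<open>graded_free_resolution_base_change\<close>).  An element of \<open>F'\<^sub>j\<close> has components
  \<open>a\<^sub>i\<close> in \<open>F'\<^sub>i\<^sub>,\<^sub>j\<close> and \<open>b\<^sub>i\<close> in \<open>F'\<^sub>i\<^sub>,\<^sub>j\<^sub>-\<^sub>1(-1)\<close>, and its boundary has components
  \<open>\<phi>\<^sub>i a\<^sub>i + x\<^sub>0 b\<^sub>i - f\<^sub>i\<^sub>+\<^sub>1 b\<^sub>i\<^sub>+\<^sub>1\<close> and \<open>-\<phi>\<^sub>i b\<^sub>i\<close>, where \<open>b\<^sub>0 = b\<^sub>m\<^sub>+\<^sub>1 = 0\<close>; so \<open>F'\<close> is an iterated
  mapping cone.  To exhibit a cycle \<open>(a, b)\<close> as a boundary, choose \<open>b'\<^sub>i\<close> such that \<open>-\<phi>\<^sub>i b'\<^sub>i = b\<^sub>i\<close>; then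
  \<open>a\<^sub>i - x\<^sub>0 b'\<^sub>i + f\<^sub>i\<^sub>+\<^sub>1 b'\<^sub>i\<^sub>+\<^sub>1\<close> is a cycle in \<open>F'\<^sub>i\<close>, hence the boundary of some \<open>a'\<^sub>i\<close>, and
  \<open>(a', b')\<close> has boundary \<open>(a, b)\<close>.  Only low degrees need care.  For \<open>j = 1\<close> one must
  know that \<open>b\<^sub>i\<close> lies in the kernel of the augmentation \<open>\<phi>\<^sub>i\<^sub>,\<^sub>0\<close>; writing \<open>\<beta>\<^sub>i = \<phi>\<^sub>i\<^sub>,\<^sub>0 b\<^sub>i\<close>, the cycle
  condition gives \<open>\<beta>\<^sub>i\<^sub>+\<^sub>1 = x\<^sub>0 \<beta>\<^sub>i\<close> and \<open>\<beta>\<^sub>0 = 0\<close>, so all \<open>\<beta>\<^sub>i\<close> vanish.  For \<open>j = 0\<close> there is no \<open>b\<close>, and the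
  \<open>b'\<^sub>i\<close> must be chosen so that \<open>\<beta>'\<^sub>i = \<phi>\<^sub>i\<^sub>,\<^sub>0 b'\<^sub>i\<close> satisfies \<open>x\<^sub>0 \<beta>'\<^sub>i - \<beta>'\<^sub>i\<^sub>+\<^sub>1 = \<phi>\<^sub>i\<^sub>,\<^sub>0 a\<^sub>i\<close>.  These equations
  determine the \<open>\<beta>'\<^sub>i\<close>, and \<open>\<beta>'\<^sub>i\<close> lies in \<open>I(Z\<^sub>i) R'\<close> because \<open>x\<^sub>0\<close> is a nonzerodivisor modulo this ideal
  (\<open>telescope_in_ideals\<close>).
\<close>


section \<open>Polynomial rings and their ideals\<close>

lemma mem_polys_iff: "q \<in> polys A \<longleftrightarrow> (\<forall>\<mu>. Poly_Mapping.lookup q \<mu> \<noteq> 0 \<longrightarrow> Poly_Mapping.keys \<mu> \<subseteq> A)"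
  by (auto simp: polys_def in_keys_iff)

lemma polys_mono: "A \<subseteq> B \<Longrightarrow> polys A \<subseteq> polys B"
  unfolding polys_def by blast

lemma zero_in_polys: "0 \<in> polys A"
  by (simp add: polys_def)

lemma one_in_polys: "1 \<in> polys A"
  by (auto simp: polys_def)

lemma add_in_polys: "q \<in> polys A \<Longrightarrow> s \<in> polys A \<Longrightarrow> q + s \<in> polys A"
  using keys_add[of q s] unfolding polys_def by blast

lemma uminus_in_polys: "q \<in> polys A \<Longrightarrow> - q \<in> polys A"
  by (simp add: mem_polys_iff)

lemma diff_in_polys: "q \<in> polys A \<Longrightarrow> s \<in> polys A \<Longrightarrow> q - s \<in> polys A"
  using add_in_polys[of q A "- s"] uminus_in_polys[of s A] by simp

lemma mult_in_polys: "q \<in> polys A \<Longrightarrow> s \<in> polys A \<Longrightarrow> q * s \<in> polys A"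
proof -
  assume q: "q \<in> polys A" and s: "s \<in> polys A"
  have "Poly_Mapping.keys \<mu> \<subseteq> A" if "\<mu> \<in> Poly_Mapping.keys (q * s)" for \<mu>
  proof -
    obtain a b where "\<mu> = a + b" "a \<in> Poly_Mapping.keys q" "b \<in> Poly_Mapping.keys s"
      using \<open>\<mu> \<in> _\<close> keys_mult[of q s] by auto
    then show ?thesis
      using keys_add[of a b] q s by (auto simp: polys_def)
  qed
  then show ?thesis
    by (simp add: polys_def)
qed

lemma sum_in_polys: "(\<And>i. i \<in> I \<Longrightarrow> q i \<in> polys A) \<Longrightarrow> sum q I \<in> polys A"
  by (induction I rule: infinite_finite_induct) (auto simp: zero_in_polys add_in_polys)

lemma power_in_polys: "q \<in> polys A \<Longrightarrow> q ^ n \<in> polys A"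
  by (induction n) (auto simp: one_in_polys mult_in_polys)

lemma Var_in_polys: "i \<in> A \<Longrightarrow> Var i \<in> polys A"
  by (auto simp: polys_def Var_def split: if_splits)

lemmas polys_closed = zero_in_polys one_in_polys add_in_polys uminus_in_polys diff_in_polys
  mult_in_polys sum_in_polys power_in_polys

lemma poly_ring_simps [simp]:
  "carrier (poly_ring A) = polys A" "monoid.mult (poly_ring A) = (*)" "one (poly_ring A) = 1"
  "zero (poly_ring A) = 0" "add (poly_ring A) = (+)"
  by (simp_all add: poly_ring_def)

lemma cring_poly_ring: "cring (poly_ring A :: 'k::comm_ring_1 mpoly ring)"
proof (rule cringI)
  show "abelian_group (poly_ring A :: 'k mpoly ring)"
  proof (rule abelian_groupI)
    fix x :: "'k mpoly" assume "x \<in> carrier (poly_ring A)"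
    then show "\<exists>y\<in>carrier (poly_ring A). y \<oplus>\<^bsub>poly_ring A\<^esub> x = \<zero>\<^bsub>poly_ring A\<^esub>"
      by (intro bexI[of _ "- x"]) (auto simp: uminus_in_polys)
  qed (auto simp: polys_closed add_ac)
  show "Group.comm_monoid (poly_ring A :: 'k mpoly ring)"
    by (rule comm_monoidI) (auto simp: polys_closed mult_ac)
qed (auto simp: algebra_simps)

lemma poly_ring_idealI:
  assumes "I \<subseteq> polys A" "0 \<in> I" "\<And>q s. q \<in> I \<Longrightarrow> s \<in> I \<Longrightarrow> q + s \<in> I"
    and mult: "\<And>q s. q \<in> I \<Longrightarrow> s \<in> polys A \<Longrightarrow> s * q \<in> I"
  shows "ideal I (poly_ring A :: 'k::comm_ring_1 mpoly ring)"
proof (rule idealI)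
  interpret cring "poly_ring A :: 'k mpoly ring" by (rule cring_poly_ring)
  show "ring (poly_ring A :: 'k mpoly ring)" by (rule ring_axioms)
  show "subgroup I (add_monoid (poly_ring A :: 'k mpoly ring))"
  proof (rule subgroup.intro)
    fix x assume x: "x \<in> I"
    have "\<ominus>\<^bsub>poly_ring A\<^esub> x = - x"
      using x assms(1) by (intro minus_equality) (auto simp: uminus_in_polys)
    moreover have "(- 1) * x \<in> I"
      by (intro mult x) (simp add: polys_closed)
    ultimately show "inv\<^bsub>add_monoid (poly_ring A)\<^esub> x \<in> I"
      by (simp add: a_inv_def)
  qed (use assms in auto)
qed (use mult in \<open>auto simp: mult.commute\<close>)

lemma
  assumes "ideal I (poly_ring A :: 'k::comm_ring_1 mpoly ring)"
  shows ideal_subset_polys: "I \<subseteq> polys A"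
    and ideal_zero: "0 \<in> I"
    and ideal_add: "\<And>q s. q \<in> I \<Longrightarrow> s \<in> I \<Longrightarrow> q + s \<in> I"
    and ideal_mult: "\<And>q s. q \<in> I \<Longrightarrow> s \<in> polys A \<Longrightarrow> s * q \<in> I"
proof -
  interpret ideal I "poly_ring A :: 'k mpoly ring" by fact
  show "I \<subseteq> polys A" "0 \<in> I" "\<And>q s. q \<in> I \<Longrightarrow> s \<in> I \<Longrightarrow> q + s \<in> I"
    "\<And>q s. q \<in> I \<Longrightarrow> s \<in> polys A \<Longrightarrow> s * q \<in> I"
    using Icarr additive_subgroup.zero_closed[OF additive_subgroup_axioms] I_l_closed
      additive_subgroup.a_closed[OF additive_subgroup_axioms] by auto
qed

lemma ideal_sum:
  assumes "ideal I (poly_ring A :: 'k::comm_ring_1 mpoly ring)" "\<And>i. i \<in> S \<Longrightarrow> q i \<in> I"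
  shows "sum q S \<in> I"
  using assms(2) by (induction S rule: infinite_finite_induct) 
    (auto simp: ideal_zero[OF assms(1)] ideal_add[OF assms(1)])


section \<open>Coefficients of the powers of \<open>x\<^sub>0\<close>\<close>

text \<open>The coefficient of \<open>x\<^sub>0\<^sup>k\<close>, as a polynomial in the other variables.\<close>

lift_definition x0_coeff :: "nat \<Rightarrow> 'k::comm_ring_1 mpoly \<Rightarrow> 'k mpoly" is
  "\<lambda>k q \<mu>. if Poly_Mapping.lookup \<mu> 0 = 0 then q (\<mu> + Poly_Mapping.single 0 k) else 0"
proof -
  fix k :: nat and q :: "(nat \<Rightarrow>\<^sub>0 nat) \<Rightarrow> 'k"
  assume fin: "finite {\<mu>. q \<mu> \<noteq> 0}"
  have "inj (\<lambda>\<mu> :: nat \<Rightarrow>\<^sub>0 nat. \<mu> + Poly_Mapping.single 0 k)"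
    by (rule injI) simp
  then have "finite ((\<lambda>\<mu>. \<mu> + Poly_Mapping.single 0 k) -` {\<mu>. q \<mu> \<noteq> 0})"
    by (rule finite_vimageI[OF fin])
  then show "finite {\<mu>. (if Poly_Mapping.lookup \<mu> 0 = 0 then q (\<mu> + Poly_Mapping.single 0 k) else 0) \<noteq> 0}"
    by (rule rev_finite_subset) auto
qed

lemma x0_coeff_zero [simp]: "x0_coeff k 0 = 0"
  by (rule poly_mapping_eqI) (simp add: x0_coeff.rep_eq)

lemma x0_coeff_add: "x0_coeff k (q + s) = x0_coeff k q + x0_coeff k s"
  by (rule poly_mapping_eqI) (simp add: x0_coeff.rep_eq lookup_add)

lemma x0_coeff_sum: "x0_coeff k (sum q S) = (\<Sum>i\<in>S. x0_coeff k (q i))"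
  by (induction S rule: infinite_finite_induct) (auto simp: x0_coeff_add)

lemma x0_coeff_single:
  "x0_coeff k (Poly_Mapping.single \<mu> c) =
    (if Poly_Mapping.lookup \<mu> 0 = k then Poly_Mapping.single (\<mu> - Poly_Mapping.single 0 k) c else 0)"
proof (rule poly_mapping_eqI)
  fix \<nu> :: "nat \<Rightarrow>\<^sub>0 nat"
  have "Poly_Mapping.lookup \<nu> 0 = 0 \<and> \<mu> = \<nu> + Poly_Mapping.single 0 k \<longleftrightarrow>
      Poly_Mapping.lookup \<mu> 0 = k \<and> \<mu> - Poly_Mapping.single 0 k = \<nu>"
    by (auto simp: poly_mapping_eq_iff fun_eq_iff lookup_add lookup_minus lookup_single when_def)
  then show "Poly_Mapping.lookup (x0_coeff k (Poly_Mapping.single \<mu> c)) \<nu> =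
    Poly_Mapping.lookup (if Poly_Mapping.lookup \<mu> 0 = k
      then Poly_Mapping.single (\<mu> - Poly_Mapping.single 0 k) c else 0) \<nu>"
    by (auto simp: x0_coeff.rep_eq lookup_single when_def)
qed

lemma poly_sum_monomials:
  "q = (\<Sum>\<mu>\<in>Poly_Mapping.keys q. Poly_Mapping.single \<mu> (Poly_Mapping.lookup q \<mu>))"
  by (rule poly_mapping_eqI)
    (auto simp: lookup_sum lookup_single when_def sum.delta' in_keys_iff)

text \<open>The \<open>R\<close>-linearity of taking coefficients; it is additive in \<open>a\<close> and \<open>q\<close>, so monomials
  suffice.\<close>

lemma x0_coeff_mult:
  assumes "a \<in> polys A" "0 \<notin> A"
  shows "x0_coeff k (a * q) = a * x0_coeff k q"
proof -
  let ?s = "\<lambda>q \<mu>. Poly_Mapping.single \<mu> (Poly_Mapping.lookup q \<mu>)"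
  have *: "x0_coeff k (?s a \<mu> * ?s q \<nu>) = ?s a \<mu> * x0_coeff k (?s q \<nu>)"
    if "\<mu> \<in> Poly_Mapping.keys a" for \<mu> \<nu>
  proof -
    have "Poly_Mapping.lookup \<mu> 0 = 0"
      using that assms by (metis in_keys_iff mem_polys_iff subsetD)
    moreover have "\<mu> + \<nu> - Poly_Mapping.single 0 k = \<mu> + (\<nu> - Poly_Mapping.single 0 k)"
      if "Poly_Mapping.lookup \<nu> 0 = k"
      by (rule poly_mapping_eqI) (use that in \<open>auto simp: lookup_minus lookup_add lookup_single when_def\<close>)
    ultimately show ?thesis
      by (simp add: mult_single x0_coeff_single lookup_add)
  qed
  have "x0_coeff k (a * q) = x0_coeff k ((\<Sum>\<mu>\<in>Poly_Mapping.keys a. ?s a \<mu>) * (\<Sum>\<nu>\<in>Poly_Mapping.keys q. ?s q \<nu>))"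
    by (simp flip: poly_sum_monomials)
  also have "\<dots> = (\<Sum>\<mu>\<in>Poly_Mapping.keys a. ?s a \<mu>) * x0_coeff k (\<Sum>\<nu>\<in>Poly_Mapping.keys q. ?s q \<nu>)"
    by (simp add: sum_product x0_coeff_sum * cong: sum.cong)
  finally show ?thesis
    by (simp flip: poly_sum_monomials)
qed

lemma Var_0_power: "Var 0 ^ j = (Poly_Mapping.single (Poly_Mapping.single 0 j) 1 :: 'k::comm_ring_1 mpoly)"
  by (induction j) (auto simp: Var_def mult_single simp flip: single_add)

lemma x0_coeff_Var_0_power_mult:
  "x0_coeff k (Var 0 ^ j * q) = (if j \<le> k then x0_coeff (k - j) q else 0)"
proof -
  let ?s = "\<lambda>\<mu>. Poly_Mapping.single \<mu> (Poly_Mapping.lookup q \<mu>)"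
  have *: "x0_coeff k (Var 0 ^ j * ?s \<mu>) = (if j \<le> k then x0_coeff (k - j) (?s \<mu>) else 0)" for \<mu>
  proof -
    have "Poly_Mapping.single 0 j + \<mu> - Poly_Mapping.single 0 k = \<mu> - Poly_Mapping.single 0 (k - j)"
      if "j \<le> k"
      by (rule poly_mapping_eqI) (use that in \<open>auto simp: lookup_minus lookup_add lookup_single when_def\<close>)
    then show ?thesis
      by (auto simp: Var_0_power mult_single x0_coeff_single lookup_add)
  qed
  have "x0_coeff k (Var 0 ^ j * q) = x0_coeff k (Var 0 ^ j * (\<Sum>\<mu>\<in>Poly_Mapping.keys q. ?s \<mu>))"
    by (simp flip: poly_sum_monomials)
  also have "\<dots> = (if j \<le> k then x0_coeff (k - j) (\<Sum>\<mu>\<in>Poly_Mapping.keys q. ?s \<mu>) else 0)"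
    by (simp add: sum_distrib_left x0_coeff_sum *)
  finally show ?thesis
    by (simp flip: poly_sum_monomials)
qed

lemma x0_coeff_in_polys: "q \<in> polys (insert 0 A) \<Longrightarrow> x0_coeff k q \<in> polys (A - {0})"
  unfolding mem_polys_iff
proof (intro allI impI)
  fix \<mu> :: "nat \<Rightarrow>\<^sub>0 nat"
  assume "\<forall>\<mu>. Poly_Mapping.lookup q \<mu> \<noteq> 0 \<longrightarrow> Poly_Mapping.keys \<mu> \<subseteq> insert 0 A"
    "Poly_Mapping.lookup (x0_coeff k q) \<mu> \<noteq> 0"
  then have "Poly_Mapping.keys (\<mu> + Poly_Mapping.single 0 k) \<subseteq> insert 0 A" "Poly_Mapping.lookup \<mu> 0 = 0"
    by (auto simp: x0_coeff.rep_eq split: if_splits)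
  moreover have "Poly_Mapping.keys \<mu> \<subseteq> Poly_Mapping.keys (\<mu> + Poly_Mapping.single 0 k)"
    by (auto simp: in_keys_iff lookup_add)
  ultimately show "Poly_Mapping.keys \<mu> \<subseteq> A - {0}"
    by (auto simp: in_keys_iff)
qed

text \<open>Every large bound is allowed, so that several polynomials can be expanded up to a common one.\<close>

lemma x0_expansion: "\<exists>N. \<forall>M\<ge>N. q = (\<Sum>k<M. Var 0 ^ k * x0_coeff k q)"
proof -
  let ?s = "\<lambda>\<mu>. Poly_Mapping.single \<mu> (Poly_Mapping.lookup q \<mu>)"
  define N where "N = Suc (Max (insert 0 ((\<lambda>\<mu>. Poly_Mapping.lookup \<mu> 0) ` Poly_Mapping.keys q)))"
  have "q = (\<Sum>k<M. Var 0 ^ k * x0_coeff k q)" if "M \<ge> N" for M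
  proof -
    have *: "(\<Sum>k<M. Var 0 ^ k * x0_coeff k (?s \<mu>)) = ?s \<mu>" if "\<mu> \<in> Poly_Mapping.keys q" for \<mu>
    proof -
      have "Poly_Mapping.lookup \<mu> 0 < N"
        unfolding N_def less_Suc_eq_le using that by (intro Max_ge) auto
      moreover have "Poly_Mapping.single 0 (Poly_Mapping.lookup \<mu> 0) +
          (\<mu> - Poly_Mapping.single 0 (Poly_Mapping.lookup \<mu> 0)) = \<mu>"
        by (rule poly_mapping_eqI) (auto simp: lookup_minus lookup_add lookup_single when_def)
      ultimately show ?thesis
        using \<open>M \<ge> N\<close> by (simp add: x0_coeff_single Var_0_power if_distrib mult_single sum.delta cong: if_cong)
    qed
    have "(\<Sum>k<M. Var 0 ^ k * x0_coeff k (\<Sum>\<mu>\<in>Poly_Mapping.keys q. ?s \<mu>)) = (\<Sum>\<mu>\<in>Poly_Mapping.keys q. ?s \<mu>)"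
      unfolding x0_coeff_sum sum_distrib_left by (subst sum.swap) (simp add: * cong: sum.cong)
    then show ?thesis
      by (simp flip: poly_sum_monomials)
  qed
  then show ?thesis by blast
qed

lemma x0_coeff_eqI:
  assumes "\<And>k. x0_coeff k q = x0_coeff k s"
  shows "q = s"
proof -
  obtain N where N: "\<forall>K\<ge>N. q = (\<Sum>k<K. Var 0 ^ k * x0_coeff k q)"
    using x0_expansion by blast
  obtain M where M: "\<forall>K\<ge>M. s = (\<Sum>k<K. Var 0 ^ k * x0_coeff k s)"
    using x0_expansion by blast
  have eq: "(\<Sum>k<max N M. Var 0 ^ k * x0_coeff k q) = (\<Sum>k<max N M. Var 0 ^ k * x0_coeff k s)"
    by (simp add: assms)
  show ?thesis
    using trans[OF trans[OF N[rule_format, OF max.cobounded1] eq]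
        M[rule_format, OF max.cobounded2, symmetric]] .
qed

text \<open>The direct sum of the \<open>x\<^sub>0\<^sup>k J\<^sub>k\<close>.  All ideals of \<open>R'\<close> below have this form.  For a constant
  family \<open>J\<^sub>k = I\<close> this is the extension \<open>I R'\<close> of an ideal \<open>I\<close> of \<open>R\<close>.\<close>

definition x0_graded :: "nat set \<Rightarrow> (nat \<Rightarrow> 'k::comm_ring_1 mpoly set) \<Rightarrow> 'k mpoly set"
  where "x0_graded A J = {q \<in> polys (insert 0 A). \<forall>k. x0_coeff k q \<in> J k}"

lemma x0_coeff_Var_0_power_mult_poly:
  fixes c :: "'k::comm_ring_1 mpoly"
  assumes "c \<in> polys A" "0 \<notin> A"
  shows "x0_coeff k (Var 0 ^ l * c) = (if k = l then c else 0)"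
proof -
  have "x0_coeff k (1 :: 'k mpoly) = (if k = 0 then 1 else 0)" for k
    using x0_coeff_single[of k 0 "1::'k"] by auto
  then have "x0_coeff k c = (if k = 0 then c else 0)" for k
    using x0_coeff_mult[OF assms, of k 1] by simp
  then show ?thesis
    by (auto simp: x0_coeff_Var_0_power_mult)
qed

lemma Var_0_power_mult_in_x0_graded:
  assumes "c \<in> J l" "c \<in> polys A" "0 \<notin> A" "\<And>k. 0 \<in> J k"
  shows "Var 0 ^ l * c \<in> x0_graded A J"
proof -
  have "Var 0 ^ l * c \<in> polys (insert 0 A)"
    using assms(2) polys_mono[of A "insert 0 A"] by (intro mult_in_polys power_in_polys Var_in_polys) auto
  then show ?thesis
    using assms by (simp add: x0_graded_def x0_coeff_Var_0_power_mult_poly)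
qed

text \<open>Multiplication by \<open>x\<^sub>0\<close> moves the coefficient at \<open>k\<close> to \<open>k + 1\<close>, so it preserves the direct sum
  because \<open>J\<close> increases.\<close>

lemma x0_graded_ideal:
  fixes J :: "nat \<Rightarrow> 'k::comm_ring_1 mpoly set"
  assumes J: "\<And>k. ideal (J k) (poly_ring A)" and mono: "\<And>k. J k \<subseteq> J (Suc k)" and "0 \<notin> A"
  shows "ideal (x0_graded A J) (poly_ring (insert 0 A))"
proof (rule poly_ring_idealI)
  show "x0_graded A J \<subseteq> polys (insert 0 A)" "0 \<in> x0_graded A J"
    by (auto simp: x0_graded_def polys_closed ideal_zero[OF J])
  show "q + s \<in> x0_graded A J" if "q \<in> x0_graded A J" "s \<in> x0_graded A J" for q s
    using that by (auto simp: x0_graded_def polys_closed x0_coeff_add ideal_add[OF J])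
  fix q s :: "'k mpoly" assume q: "q \<in> x0_graded A J" and s: "s \<in> polys (insert 0 A)"
  have "x0_coeff k (s * q) \<in> J k" for k
  proof -
    obtain N where N: "\<forall>M\<ge>N. s = (\<Sum>l<M. Var 0 ^ l * x0_coeff l s)"
      using x0_expansion by blast
    have s_l: "x0_coeff l s \<in> polys A" for l
      using x0_coeff_in_polys[OF s, of l] \<open>0 \<notin> A\<close> by simp
    have "x0_coeff k (s * q) = x0_coeff k ((\<Sum>l<N. Var 0 ^ l * x0_coeff l s) * q)"
      using N[rule_format, of N] by (rule arg_cong[of _ _ "\<lambda>s. x0_coeff k (s * q)"]) simp
    also have "\<dots> = (\<Sum>l<N. if l \<le> k then x0_coeff l s * x0_coeff (k - l) q else 0)"
      by (simp add: sum_distrib_right x0_coeff_sum mult.assoc x0_coeff_Var_0_power_mult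
          x0_coeff_mult[OF s_l \<open>0 \<notin> A\<close>] cong: if_cong)
    also have "\<dots> \<in> J k"
    proof (rule ideal_sum[OF J])
      fix l
      have "J (k - l) \<subseteq> J k"
        by (rule lift_Suc_mono_le[of J, OF mono]) simp
      moreover have "x0_coeff l s * x0_coeff (k - l) q \<in> J (k - l)"
        using q s_l by (intro ideal_mult[OF J]) (auto simp: x0_graded_def)
      ultimately show "(if l \<le> k then x0_coeff l s * x0_coeff (k - l) q else 0) \<in> J k"
        using ideal_zero[OF J] by auto
    qed
    finally show ?thesis .
  qed
  then show "s * q \<in> x0_graded A J"
    using q s by (auto simp: x0_graded_def mult_in_polys)
qed

text \<open>That is, \<open>x\<^sub>0\<close> is a nonzerodivisor modulo an ideal extended from \<open>R\<close>.\<close>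

lemma x0_graded_saturated:
  assumes "q \<in> polys (insert 0 A)" "Var 0 * q \<in> x0_graded A (\<lambda>_. I)"
  shows "q \<in> x0_graded A (\<lambda>_. I)"
proof -
  have "x0_coeff k q = x0_coeff (Suc k) (Var 0 * q)" for k
    using x0_coeff_Var_0_power_mult[of "Suc k" 1 q] by simp
  then show ?thesis
    using assms by (simp add: x0_graded_def)
qed

lemma x0_split:
  fixes q :: "'k::comm_ring_1 mpoly"
  assumes "q \<in> polys (insert 0 A)"
  obtains s where "s \<in> polys (insert 0 A)" "q = x0_coeff 0 q + Var 0 * s"
proof -
  obtain N where "\<forall>M\<ge>N. q = (\<Sum>k<M. Var 0 ^ k * x0_coeff k q)"
    using x0_expansion by blast
  from this[rule_format, of "Suc N"] have "q = (\<Sum>k<Suc N. Var 0 ^ k * x0_coeff k q)" by simp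
  also have "\<dots> = x0_coeff 0 q + Var 0 * (\<Sum>k<N. Var 0 ^ k * x0_coeff (Suc k) q)"
    by (subst sum.lessThan_Suc_shift) (simp add: sum_distrib_left mult.assoc)
  finally have "q = x0_coeff 0 q + Var 0 * (\<Sum>k<N. Var 0 ^ k * x0_coeff (Suc k) q)" .
  moreover have "x0_coeff k q \<in> polys (insert 0 A)" for k
    using x0_coeff_in_polys[OF assms] polys_mono[of "A - {0}" "insert 0 A"] by auto
  then have "(\<Sum>k<N. Var 0 ^ k * x0_coeff (Suc k) q) \<in> polys (insert 0 A)"
    by (intro sum_in_polys mult_in_polys power_in_polys Var_in_polys) auto
  ultimately show ?thesis
    using that by blast
qed

text \<open>The summand with index \<open>i\<close> contributes \<open>J\<^bsub>m-i\<^esub>\<close> to every coefficient from \<open>m - i\<close> on.  So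
  the coefficient at \<open>k\<close> ranges over the sum of the \<open>J\<^sub>l\<close> with \<open>l \<le> min k m\<close>, and the last of
  them is the largest.\<close>

lemma sum_of_x0_shifts_eq_x0_graded:
  fixes J :: "nat \<Rightarrow> 'k::comm_ring_1 mpoly set"
  assumes J: "\<And>k. ideal (J k) (poly_ring A)" and mono: "\<And>k. J k \<subseteq> J (Suc k)" and "0 \<notin> A"
    and stable: "\<And>k. m \<le> k \<Longrightarrow> J k = J m"
  shows "{q. \<exists>\<alpha>. (\<forall>i\<le>m. \<alpha> i \<in> x0_graded A (\<lambda>_. J (m - i))) \<and>
      q = (\<Sum>i\<le>m. Var 0 ^ (m - i) * \<alpha> i)} = x0_graded A J" (is "?S = _")
proof (intro equalityI subsetI)
  fix q assume "q \<in> ?S"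
  then have "\<exists>\<alpha>. (\<forall>i\<le>m. \<alpha> i \<in> x0_graded A (\<lambda>_. J (m - i))) \<and> q = (\<Sum>i\<le>m. Var 0 ^ (m - i) * \<alpha> i)"
    by (rule CollectD)
  then obtain \<alpha> where
    "(\<forall>i\<le>m. \<alpha> i \<in> x0_graded A (\<lambda>_. J (m - i))) \<and> q = (\<Sum>i\<le>m. Var 0 ^ (m - i) * \<alpha> i)" ..
  then have \<alpha>: "\<And>i. i \<le> m \<Longrightarrow> \<alpha> i \<in> x0_graded A (\<lambda>_. J (m - i))"
    and q: "q = (\<Sum>i\<le>m. Var 0 ^ (m - i) * \<alpha> i)"
    by simp_all
  have "Var 0 ^ (m - i) * \<alpha> i \<in> x0_graded A J" if "i \<le> m" for i
  proof -
    have "x0_coeff k (Var 0 ^ (m - i) * \<alpha> i) \<in> J k" for k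
    proof (cases "m - i \<le> k")
      case True
      then have "J (m - i) \<subseteq> J k"
        by (rule lift_Suc_mono_le[of J, OF mono])
      then show ?thesis
        using True \<alpha>[OF that] by (auto simp: x0_coeff_Var_0_power_mult x0_graded_def)
    qed (simp add: x0_coeff_Var_0_power_mult ideal_zero[OF J])
    moreover have "Var 0 ^ (m - i) * \<alpha> i \<in> polys (insert 0 A)"
      using \<alpha>[OF that] by (intro mult_in_polys power_in_polys Var_in_polys) (auto simp: x0_graded_def)
    ultimately show ?thesis
      by (simp add: x0_graded_def)
  qed
  then show "q \<in> x0_graded A J"
    unfolding q by (intro ideal_sum[OF x0_graded_ideal[of J, OF J mono \<open>0 \<notin> A\<close>]]) auto
next
  fix q assume q: "q \<in> x0_graded A J"
  obtain N where "\<forall>M\<ge>N. q = (\<Sum>k<M. Var 0 ^ k * x0_coeff k q)"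
    using x0_expansion by blast
  from this[rule_format, OF order_refl] have N: "q = (\<Sum>k<N. Var 0 ^ k * x0_coeff k q)" .
  \<comment> \<open>The term of exponent \<open>k\<close> goes to the index \<open>i = m - k\<close>, and to \<open>i = 0\<close> if \<open>k > m\<close>.\<close>
  define \<alpha> where
    "\<alpha> i = (\<Sum>k<N. if i = m - min k m then Var 0 ^ (k - (m - i)) * x0_coeff k q else 0)" for i
  have const: "ideal (x0_graded A (\<lambda>_. J (m - i))) (poly_ring (insert 0 A))" for i
    by (rule x0_graded_ideal) (use J \<open>0 \<notin> A\<close> in auto)
  have "\<alpha> i \<in> x0_graded A (\<lambda>_. J (m - i))" if "i \<le> m" for i
    unfolding \<alpha>_def
  proof (rule ideal_sum[OF const])
    fix k
    have "J k = J (min k m)"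
      using stable[of k] by (auto simp: min_def)
    moreover have "x0_coeff k q \<in> J k"
      using q by (simp add: x0_graded_def)
    ultimately have "x0_coeff k q \<in> J (m - i)" if "i = m - min k m"
      using that by simp
    moreover have "x0_coeff k q \<in> polys A"
      using x0_coeff_in_polys[of q A k] q \<open>0 \<notin> A\<close> by (simp add: x0_graded_def)
    ultimately show "(if i = m - min k m then Var 0 ^ (k - (m - i)) * x0_coeff k q else 0) \<in>
        x0_graded A (\<lambda>_. J (m - i))"
      using \<open>0 \<notin> A\<close> ideal_zero[OF J] ideal_zero[OF const]
      by (auto intro!: Var_0_power_mult_in_x0_graded)
  qed
  moreover have "q = (\<Sum>i\<le>m. Var 0 ^ (m - i) * \<alpha> i)"
  proof -
    have "(\<Sum>i\<le>m. Var 0 ^ (m - i) * \<alpha> i) =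
      (\<Sum>k<N. \<Sum>i\<le>m. if i = m - min k m then Var 0 ^ (m - i) * (Var 0 ^ (k - (m - i)) * x0_coeff k q) else 0)"
      unfolding \<alpha>_def sum_distrib_left by (subst sum.swap) (intro sum.cong refl, simp)
    also have "\<dots> = (\<Sum>k<N. Var 0 ^ k * x0_coeff k q)"
    proof (rule sum.cong[OF refl])
      fix k
      have "(\<Sum>i\<le>m. if i = m - min k m then Var 0 ^ (m - i) * (Var 0 ^ (k - (m - i)) * x0_coeff k q) else 0) =
        Var 0 ^ min k m * (Var 0 ^ (k - min k m) * x0_coeff k q)"
        by (simp add: sum.delta)
      also have "\<dots> = Var 0 ^ (min k m + (k - min k m)) * x0_coeff k q"
        by (simp only: power_add mult.assoc)
      finally show "(\<Sum>i\<le>m. if i = m - min k m then Var 0 ^ (m - i) * (Var 0 ^ (k - (m - i)) * x0_coeff k q) else 0) =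
        Var 0 ^ k * x0_coeff k q"
        by simp
    qed
    finally show ?thesis
      using N by simp
  qed
  ultimately show "q \<in> ?S" 
    unfolding mem_Collect_eq by (intro exI[of _ \<alpha>]) simp
qed


section \<open>Homogeneous polynomials and evaluation\<close>

lemma x0_coeff_eval:
  assumes "v 0 = 0"
  shows "mpoly_eval v (x0_coeff 0 q) = mpoly_eval v q"
proof -
  have keys: "Poly_Mapping.keys (x0_coeff 0 q) = {\<mu> \<in> Poly_Mapping.keys q. Poly_Mapping.lookup \<mu> 0 = 0}"
    by (auto simp: in_keys_iff x0_coeff.rep_eq split: if_splits)
  have "(\<Prod>i\<in>Poly_Mapping.keys \<mu>. v i ^ Poly_Mapping.lookup \<mu> i) = 0" if "Poly_Mapping.lookup \<mu> 0 \<noteq> 0" for \<mu>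
    using that assms by (intro prod_zero) (auto simp: in_keys_iff power_0_left intro!: bexI[of _ 0])
  then show ?thesis
    unfolding mpoly_eval_def keys
    by (intro sum.mono_neutral_cong_left) (auto simp: x0_coeff.rep_eq)
qed

lemma homog_x0_coeff: "homog n q \<Longrightarrow> homog n (x0_coeff 0 q)"
  by (auto simp: homog_def in_keys_iff x0_coeff.rep_eq split: if_splits)

lemma mdeg_eq_sum: "finite S \<Longrightarrow> Poly_Mapping.keys \<mu> \<subseteq> S \<Longrightarrow> mdeg \<mu> = (\<Sum>i\<in>S. Poly_Mapping.lookup \<mu> i)"
  unfolding mdeg_def by (rule sum.mono_neutral_left) (auto simp: in_keys_iff)

lemma mdeg_add: "mdeg (\<mu> + \<nu>) = mdeg \<mu> + mdeg \<nu>"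
proof -
  let ?S = "Poly_Mapping.keys \<mu> \<union> Poly_Mapping.keys \<nu>"
  have "mdeg (\<mu> + \<nu>) = (\<Sum>i\<in>?S. Poly_Mapping.lookup (\<mu> + \<nu>) i)"
    by (rule mdeg_eq_sum) (use keys_add[of \<mu> \<nu>] in auto)
  then show ?thesis
    using mdeg_eq_sum[of ?S \<mu>] mdeg_eq_sum[of ?S \<nu>] by (simp add: lookup_add sum.distrib)
qed

lemma homog_mult: "homog a q \<Longrightarrow> homog b s \<Longrightarrow> homog (a + b) (q * s)"
  using keys_mult[of q s] unfolding homog_def by (fastforce simp: mdeg_add)

lemma homog_Var: "homog 1 (Var i)"
  by (auto simp: homog_def Var_def mdeg_def)

lemma homog_zero: "homog n 0"
  by (simp add: homog_def)

lemma homog_one: "homog 0 1"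
  by (simp add: homog_def mdeg_def)

lemma homog_Var_power: "homog (int n) (Var i ^ n)"
proof (induction n)
  case (Suc n)
  then show ?case using homog_mult[OF homog_Var Suc] by simp
qed (simp add: homog_one)


section \<open>Linear maps and exactness\<close>

lemma lin_ext_zero [simp]: "lin_ext G \<phi> (\<lambda>_. 0) = (\<lambda>_. 0)"
  by (simp add: lin_ext_def)

lemma lin_ext_add: "lin_ext G \<phi> (\<lambda>g. v g + w g) = (\<lambda>h. lin_ext G \<phi> v h + lin_ext G \<phi> w h)"
  by (simp add: lin_ext_def ring_distribs sum.distrib)

lemma lin_ext_uminus: "lin_ext G \<phi> (\<lambda>g. - v g) = (\<lambda>h. - lin_ext G \<phi> v h)"
  by (simp add: lin_ext_def sum_negf)

lemma lin_ext_diff: "lin_ext G \<phi> (\<lambda>g. v g - w g) = (\<lambda>h. lin_ext G \<phi> v h - lin_ext G \<phi> w h)"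
  by (simp add: lin_ext_def ring_distribs sum_subtractf)

lemma lin_ext_scale: "lin_ext G \<phi> (\<lambda>g. c * v g) = (\<lambda>h. c * lin_ext G \<phi> v h)"
  by (simp add: lin_ext_def sum_distrib_left mult.assoc)

lemma lin_ext_sum: "lin_ext G \<phi> (\<lambda>g. \<Sum>k\<in>S. v k g) = (\<lambda>h. \<Sum>k\<in>S. lin_ext G \<phi> (v k) h)"
  unfolding lin_ext_def sum_distrib_right by (subst sum.swap) (rule refl)

lemma lin_form_eq_lin_ext: "lin_form G \<epsilon> v = lin_ext G (\<lambda>g _. \<epsilon> g) v ()"
  by (simp add: lin_form_def lin_ext_def)

lemma bdry_map_linear:
  "bdry_map C j (\<lambda>_. 0) = (\<lambda>_. 0)"
  "bdry_map C j (\<lambda>g. v g + w g) = (\<lambda>h. bdry_map C j v h + bdry_map C j w h)"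
  "bdry_map C j (\<lambda>g. - v g) = (\<lambda>h. - bdry_map C j v h)"
  "bdry_map C j (\<lambda>g. v g - w g) = (\<lambda>h. bdry_map C j v h - bdry_map C j w h)"
  "bdry_map C j (\<lambda>g. c * v g) = (\<lambda>h. c * bdry_map C j v h)"
  by (simp_all add: bdry_map_def lin_ext_add lin_ext_uminus lin_ext_diff lin_ext_scale)

lemma aug_map_linear:
  "aug_map C (\<lambda>_. 0) = 0"
  "aug_map C (\<lambda>g. v g + w g) = aug_map C v + aug_map C w"
  "aug_map C (\<lambda>g. v g - w g) = aug_map C v - aug_map C w"
  "aug_map C (\<lambda>g. c * v g) = c * aug_map C v"
  by (simp_all add: aug_map_def lin_form_eq_lin_ext lin_ext_add lin_ext_diff lin_ext_scale)

lemma free_mod_closed: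
  "(\<lambda>_. 0) \<in> free_mod A G"
  "v \<in> free_mod A G \<Longrightarrow> w \<in> free_mod A G \<Longrightarrow> (\<lambda>g. v g + w g) \<in> free_mod A G"
  "v \<in> free_mod A G \<Longrightarrow> (\<lambda>g. - v g) \<in> free_mod A G"
  "v \<in> free_mod A G \<Longrightarrow> w \<in> free_mod A G \<Longrightarrow> (\<lambda>g. v g - w g) \<in> free_mod A G"
  "c \<in> polys A \<Longrightarrow> v \<in> free_mod A G \<Longrightarrow> (\<lambda>g. c * v g) \<in> free_mod A G"
  by (auto simp: free_mod_def polys_closed)

lemma free_mod_mono: "A \<subseteq> B \<Longrightarrow> free_mod A G \<subseteq> free_mod B G"
  using polys_mono unfolding free_mod_def by blast

lemma lin_ext_in_free_mod:
  "v \<in> free_mod A G \<Longrightarrow> (\<And>g. g \<in> G \<Longrightarrow> \<phi> g \<in> free_mod A H) \<Longrightarrow> lin_ext G \<phi> v \<in> free_mod A H"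
  by (auto simp: free_mod_def lin_ext_def intro!: sum_in_polys mult_in_polys)

lemma bdry_map_in_chains:
  "graded_free A C \<Longrightarrow> v \<in> chains A C (Suc j) \<Longrightarrow> bdry_map C (Suc j) v \<in> chains A C j"
  unfolding chains_def bdry_map_def
  by (rule lin_ext_in_free_mod) (auto simp: graded_free_def homog_elem_def)

lemma aug_map_in_polys:
  "graded_free A C \<Longrightarrow> v \<in> chains A C 0 \<Longrightarrow> aug_map C v \<in> polys A"
  by (auto simp: aug_map_def lin_form_def chains_def free_mod_def graded_free_def
      intro!: sum_in_polys mult_in_polys)

text \<open>Exactness with the homological degrees written as successors, which avoids subtraction.\<close>

lemma graded_free_resolution_iff:
  "graded_free_resolution A C I \<longleftrightarrow>
    graded_free A C \<and>
    aug_map C ` chains A C 0 = I \<and>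
    bdry_map C (Suc 0) ` chains A C (Suc 0) = {v \<in> chains A C 0. aug_map C v = 0} \<and>
    (\<forall>j. bdry_map C (Suc (Suc j)) ` chains A C (Suc (Suc j)) =
       {v \<in> chains A C (Suc j). bdry_map C (Suc j) v = (\<lambda>_. 0)})"
proof -
  have "(\<forall>j\<ge>2. P j (j - 1)) \<longleftrightarrow> (\<forall>j. P (Suc (Suc j)) (Suc j))" for P :: "nat \<Rightarrow> nat \<Rightarrow> bool"
  proof (intro iffI allI impI)
    fix j :: nat assume "2 \<le> j" "\<forall>j. P (Suc (Suc j)) (Suc j)"
    then show "P j (j - 1)"
      using spec[of "\<lambda>j. P (Suc (Suc j)) (Suc j)" "j - 2"] by (simp add: numeral_2_eq_2 Suc_diff_Suc)
  next
    fix j assume "\<forall>j\<ge>2. P j (j - 1)"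
    from this[rule_format, of "Suc (Suc j)"] show "P (Suc (Suc j)) (Suc j)" by simp
  qed
  from this[of "\<lambda>j j'. bdry_map C j ` chains A C j = {v \<in> chains A C j'. bdry_map C j' v = (\<lambda>_. 0)}"]
  show ?thesis
    unfolding graded_free_resolution_def by simp
qed


section \<open>Base change from \<open>R\<close> to \<open>R'\<close>\<close>

lemma x0_coeff_lin_ext:
  assumes "\<And>g. g \<in> G \<Longrightarrow> \<phi> g h \<in> polys A" "0 \<notin> A"
  shows "x0_coeff k (lin_ext G \<phi> v h) = lin_ext G \<phi> (\<lambda>g. x0_coeff k (v g)) h"
  unfolding lin_ext_def x0_coeff_sum
  using x0_coeff_mult[OF assms] by (intro sum.cong) (auto simp: mult.commute)

lemma x0_coeff_in_free_mod:
  "v \<in> free_mod (insert 0 A) G \<Longrightarrow> 0 \<notin> A \<Longrightarrow> (\<lambda>g. x0_coeff k (v g)) \<in> free_mod A G"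
  using x0_coeff_in_polys[of _ A k] by (auto simp: free_mod_def)

text \<open>A preimage is assembled from preimages of the coefficients of the powers of \<open>x\<^sub>0\<close>; as there are
  finitely many entries, finitely many powers suffice.\<close>

lemma lin_ext_image_base_change:
  assumes "finite G" and v: "v \<in> free_mod (insert 0 A) G"
    and coeffs: "\<And>k. (\<lambda>g. x0_coeff k (v g)) \<in> lin_ext H \<psi> ` free_mod A H"
  shows "v \<in> lin_ext H \<psi> ` free_mod (insert 0 A) H"
proof -
  obtain w where w: "\<And>k. w k \<in> free_mod A H" "\<And>k. lin_ext H \<psi> (w k) = (\<lambda>g. x0_coeff k (v g))"
    using coeffs by (auto simp: image_iff) metis
  obtain N where N: "\<And>g M. M \<ge> N g \<Longrightarrow> v g = (\<Sum>k<M. Var 0 ^ k * x0_coeff k (v g))"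
    using x0_expansion[of "v g" for g] by metis
  define M where "M = Max (insert 0 (N ` G))"
  have M: "v g = (\<Sum>k<M. Var 0 ^ k * x0_coeff k (v g))" for g
  proof (cases "g \<in> G")
    case True
    then show ?thesis
      using \<open>finite G\<close> by (intro N) (auto simp add: M_def)
  next
    case False
    then show ?thesis
      using v by (simp add: free_mod_def)
  qed
  have "lin_ext H \<psi> (\<lambda>h. \<Sum>k<M. Var 0 ^ k * w k h) = (\<lambda>g. \<Sum>k<M. Var 0 ^ k * x0_coeff k (v g))"
    by (simp add: lin_ext_sum lin_ext_scale w)
  also have "\<dots> = v"
    by (rule ext) (rule M[symmetric])
  finally have eq: "lin_ext H \<psi> (\<lambda>h. \<Sum>k<M. Var 0 ^ k * w k h) = v" .
  have mem: "(\<lambda>h. \<Sum>k<M. Var 0 ^ k * w k h) \<in> free_mod (insert 0 A) H"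
  proof -
    have "Var 0 ^ k * w k h \<in> polys (insert 0 A)" if "h \<in> H" for k h
      using w(1)[of k] polys_mono[of A "insert 0 A"] that
      by (intro mult_in_polys power_in_polys Var_in_polys) (auto simp: free_mod_def)
    moreover have "w k h = 0" if "h \<notin> H" for k h
      using w(1)[of k] that by (simp add: free_mod_def)
    ultimately show ?thesis
      by (simp add: free_mod_def sum_in_polys)
  qed
  show ?thesis
    using mem by (rule image_eqI[rotated]) (rule eq[symmetric])
qed

text \<open>The flatness of \<open>R'\<close> over \<open>R\<close>: as maps defined over \<open>R\<close> commute with taking coefficients, both
  sides are determined coefficientwise by the exact sequence over \<open>R\<close>.\<close>

lemma exact_base_change:
  assumes exact: "lin_ext H \<psi> ` free_mod A H = {v \<in> free_mod A G. lin_ext G \<phi> v = (\<lambda>_. 0)}"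
    and "0 \<notin> A" "finite G"
    and \<psi>: "\<And>h. h \<in> H \<Longrightarrow> \<psi> h \<in> free_mod A G"
    and \<phi>: "\<And>g k. g \<in> G \<Longrightarrow> \<phi> g k \<in> polys A"
  shows "lin_ext H \<psi> ` free_mod (insert 0 A) H =
    {v \<in> free_mod (insert 0 A) G. lin_ext G \<phi> v = (\<lambda>_. 0)}"
proof (intro equalityI subsetI)
  fix v assume v: "v \<in> {v \<in> free_mod (insert 0 A) G. lin_ext G \<phi> v = (\<lambda>_. 0)}"
  have "(\<lambda>g. x0_coeff k (v g)) \<in> lin_ext H \<psi> ` free_mod A H" for k
  proof -
    have "lin_ext G \<phi> (\<lambda>g. x0_coeff k (v g)) = (\<lambda>h. x0_coeff k (lin_ext G \<phi> v h))"
      using \<phi> by (intro ext x0_coeff_lin_ext[OF _ \<open>0 \<notin> A\<close>, symmetric])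
    then show ?thesis
      unfolding exact using v x0_coeff_in_free_mod[of v A G k] \<open>0 \<notin> A\<close> by simp
  qed
  then show "v \<in> lin_ext H \<psi> ` free_mod (insert 0 A) H"
    using lin_ext_image_base_change[OF \<open>finite G\<close>] v by blast
next
  fix v assume "v \<in> lin_ext H \<psi> ` free_mod (insert 0 A) H"
  then obtain w where w: "w \<in> free_mod (insert 0 A) H" "v = lin_ext H \<psi> w" by blast
  have "v \<in> free_mod (insert 0 A) G"
    unfolding w(2) using \<psi> free_mod_mono[of A "insert 0 A" G] w(1)
    by (intro lin_ext_in_free_mod) auto
  moreover have "lin_ext G \<phi> v h = 0" for h
  proof (rule x0_coeff_eqI)
    fix k
    have \<psi>': "\<psi> h' g \<in> polys A" if "h' \<in> H" for h' g
      using \<psi>[OF that] by (cases "g \<in> G") (auto simp: free_mod_def polys_closed)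
    have "x0_coeff k (lin_ext G \<phi> v h) = lin_ext G \<phi> (\<lambda>g. x0_coeff k (v g)) h"
      using \<phi> by (rule x0_coeff_lin_ext[OF _ \<open>0 \<notin> A\<close>])
    also have "(\<lambda>g. x0_coeff k (v g)) = lin_ext H \<psi> (\<lambda>h. x0_coeff k (w h))"
      unfolding w(2) using \<psi>' by (intro ext x0_coeff_lin_ext[OF _ \<open>0 \<notin> A\<close>])
    also have "lin_ext G \<phi> \<dots> = (\<lambda>_. 0)"
      using exact x0_coeff_in_free_mod[OF w(1) \<open>0 \<notin> A\<close>, of k] by blast
    finally show "x0_coeff k (lin_ext G \<phi> v h) = x0_coeff k 0" by simp
  qed
  ultimately show "v \<in> {v \<in> free_mod (insert 0 A) G. lin_ext G \<phi> v = (\<lambda>_. 0)}" by auto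
qed

lemma graded_free_mono:
  assumes "graded_free A C" "A \<subseteq> B"
  shows "graded_free B C"
  using assms polys_mono[of A B] free_mod_mono[of A B]
  unfolding graded_free_def homog_elem_def by (meson subsetD)

lemma graded_free_resolution_base_change:
  assumes C: "graded_free_resolution A C I" and "0 \<notin> A"
  shows "graded_free_resolution (insert 0 A) C (x0_graded A (\<lambda>_. I))"
  unfolding graded_free_resolution_iff
proof (intro conjI allI)
  let ?B = "insert 0 A"
  have gf: "graded_free A C" and im: "aug_map C ` chains A C 0 = I"
    and ex0: "bdry_map C (Suc 0) ` chains A C (Suc 0) = {v \<in> chains A C 0. aug_map C v = 0}"
    and ex: "bdry_map C (Suc (Suc j)) ` chains A C (Suc (Suc j)) =
       {v \<in> chains A C (Suc j). bdry_map C (Suc j) v = (\<lambda>_. 0)}" for j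
    using C unfolding graded_free_resolution_iff by blast+
  show gf': "graded_free ?B C"
    using graded_free_mono[OF gf] by blast
  have fin: "finite (gens C j)" for j
    using gf by (simp add: graded_free_def)
  have \<phi>: "bdry C (Suc j) g \<in> free_mod A (gens C j)" if "g \<in> gens C (Suc j)" for j g
    using gf that by (auto simp: graded_free_def homog_elem_def)
  have \<phi>': "bdry C (Suc j) g h \<in> polys A" if "g \<in> gens C (Suc j)" for j g h
    using \<phi>[OF that] by (cases "h \<in> gens C j") (auto simp: free_mod_def polys_closed)
  have \<epsilon>: "aug C g \<in> polys A" if "g \<in> gens C 0" for g
    using gf that by (auto simp: graded_free_def)
  have aug: "aug_map C v = 0 \<longleftrightarrow> lin_ext (gens C 0) (\<lambda>g (_::unit). aug C g) v = (\<lambda>_. 0)" for v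
    by (auto simp: aug_map_def lin_form_eq_lin_ext fun_eq_iff)
  show "bdry_map C (Suc 0) ` chains ?B C (Suc 0) = {v \<in> chains ?B C 0. aug_map C v = 0}"
    using ex0 unfolding aug bdry_map_def chains_def
    by (rule exact_base_change) (use assms fin \<phi> \<epsilon> in auto)
  show "bdry_map C (Suc (Suc j)) ` chains ?B C (Suc (Suc j)) =
       {v \<in> chains ?B C (Suc j). bdry_map C (Suc j) v = (\<lambda>_. 0)}" for j
    using ex unfolding bdry_map_def chains_def
    by (rule exact_base_change) (use assms fin \<phi> \<phi>' in auto)
  have coeff: "x0_coeff k (aug_map C v) = aug_map C (\<lambda>g. x0_coeff k (v g))" for v k
    unfolding aug_map_def lin_form_eq_lin_ext using \<epsilon> by (rule x0_coeff_lin_ext[OF _ \<open>0 \<notin> A\<close>])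
  show "aug_map C ` chains ?B C 0 = x0_graded A (\<lambda>_. I)"
  proof (intro equalityI subsetI)
    fix q assume "q \<in> aug_map C ` chains ?B C 0"
    then obtain v where v: "v \<in> chains ?B C 0" "q = aug_map C v" by blast
    have "x0_coeff k q \<in> I" for k
      using x0_coeff_in_free_mod[OF v(1)[unfolded chains_def] \<open>0 \<notin> A\<close>, of k]
      unfolding v(2) coeff by (auto simp: chains_def simp flip: im)
    then show "q \<in> x0_graded A (\<lambda>_. I)"
      using aug_map_in_polys[OF gf' v(1)] v(2) by (auto simp: x0_graded_def)
  next
    fix q assume q: "q \<in> x0_graded A (\<lambda>_. I)"
    let ?\<epsilon> = "\<lambda>g (_::unit). aug C g"
    \<comment> \<open>The ring is the free module on one generator, indexed here by \<open>unit\<close>.\<close>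
    have "(\<lambda>_. q) \<in> lin_ext (gens C 0) ?\<epsilon> ` free_mod ?B (gens C 0)"
    proof (rule lin_ext_image_base_change[of UNIV])
      fix k
      have "x0_coeff k q \<in> aug_map C ` chains A C 0"
        using q by (simp add: im x0_graded_def)
      then obtain w where "w \<in> chains A C 0" "x0_coeff k q = aug_map C w" by blast
      then show "(\<lambda>_. x0_coeff k q) \<in> lin_ext (gens C 0) ?\<epsilon> ` free_mod A (gens C 0)"
        by (intro image_eqI[of _ _ w]) (auto simp: chains_def aug_map_def lin_form_eq_lin_ext)
    qed (use q in \<open>auto simp: x0_graded_def free_mod_def\<close>)
    then obtain w where "w \<in> free_mod ?B (gens C 0)" "(\<lambda>_. q) = lin_ext (gens C 0) ?\<epsilon> w" by blast
    then show "q \<in> aug_map C ` chains ?B C 0"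
      by (intro image_eqI[of _ _ w]) (auto simp: chains_def aug_map_def lin_form_eq_lin_ext fun_eq_iff)
  qed
qed

lemma lifts_inclusion_base_change:
  fixes C D :: "('g, 'k::comm_ring_1 mpoly) gcomplex"
  assumes f: "lifts_inclusion A C D f" and C: "graded_free A C" and D: "graded_free A D" and "0 \<notin> A"
  shows "lifts_inclusion (insert 0 A) C D f"
proof -
  have f_mod: "f j g \<in> free_mod A (gens D j)" if "g \<in> gens C j" for j g
    using f that by (auto simp: lifts_inclusion_def homog_elem_def)
  have bdry_mod: "bdry E (Suc j) g \<in> free_mod A (gens E j)"
    if "graded_free A E" "g \<in> gens E (Suc j)" for E :: "('g, 'k mpoly) gcomplex" and j g
    using that by (auto simp: graded_free_def homog_elem_def)
  have polys: "v g \<in> polys A" if "v \<in> free_mod A G" for v :: "'g \<Rightarrow> 'k mpoly" and G g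
    using that by (cases "g \<in> G") (auto simp: free_mod_def polys_closed)
  have cf: "x0_coeff k (lin_ext (gens C j) (f j) v h) = lin_ext (gens C j) (f j) (\<lambda>g. x0_coeff k (v g)) h" for k j v h
    using polys[OF f_mod] by (rule x0_coeff_lin_ext[OF _ \<open>0 \<notin> A\<close>])
  have cb: "x0_coeff k (bdry_map E (Suc j) v h) = bdry_map E (Suc j) (\<lambda>g. x0_coeff k (v g)) h"
    if "graded_free A E" for E :: "('g, 'k mpoly) gcomplex" and k j v h
    unfolding bdry_map_def using polys[OF bdry_mod[OF that]] by (rule x0_coeff_lin_ext[OF _ \<open>0 \<notin> A\<close>])
  have ca: "x0_coeff k (aug_map E v) = aug_map E (\<lambda>g. x0_coeff k (v g))"
    if "graded_free A E" for E :: "('g, 'k mpoly) gcomplex" and k v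
    unfolding aug_map_def lin_form_eq_lin_ext
    by (rule x0_coeff_lin_ext[OF _ \<open>0 \<notin> A\<close>]) (use that in \<open>auto simp: graded_free_def\<close>)
  have cv: "(\<lambda>g. x0_coeff k (v g)) \<in> chains A C j" if "v \<in> chains (insert 0 A) C j" for v k j
    using x0_coeff_in_free_mod that \<open>0 \<notin> A\<close> unfolding chains_def by blast
  show ?thesis
    unfolding lifts_inclusion_def
  proof (intro conjI allI ballI)
    fix j g assume "g \<in> gens C j"
    then show "homog_elem (insert 0 A) (gens D j) (gdeg D j) (gdeg C j g) (f j g)"
      using f free_mod_mono[of A "insert 0 A"] unfolding lifts_inclusion_def homog_elem_def by blast
  next
    fix j v assume v: "v \<in> chains (insert 0 A) C (Suc j)"
    show "lin_ext (gens C j) (f j) (bdry_map C (Suc j) v) =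
       bdry_map D (Suc j) (lin_ext (gens C (Suc j)) (f (Suc j)) v)"
    proof (rule ext, rule x0_coeff_eqI)
      fix h k
      show "x0_coeff k (lin_ext (gens C j) (f j) (bdry_map C (Suc j) v) h) =
       x0_coeff k (bdry_map D (Suc j) (lin_ext (gens C (Suc j)) (f (Suc j)) v) h)"
        using f cv[OF v, of k] by (simp add: cf cb C D lifts_inclusion_def)
    qed
  next
    fix v assume v: "v \<in> chains (insert 0 A) C 0"
    show "aug_map C v = aug_map D (lin_ext (gens C 0) (f 0) v)"
    proof (rule x0_coeff_eqI)
      fix k
      show "x0_coeff k (aug_map C v) = x0_coeff k (aug_map D (lin_ext (gens C 0) (f 0) v))"
        using f cv[OF v, of k] by (simp add: cf ca C D lifts_inclusion_def)
    qed
  qed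
qed


section \<open>The components of \<open>F'\<close>\<close>

lemma tot_complex_simps [simp]:
  "gens (tot_complex m F f) = tot_gens m F" "gdeg (tot_complex m F f) = tot_deg m F"
  "aug (tot_complex m F f) = tot_aug m F" "bdry (tot_complex m F f) = tot_bdry F f"
  by (simp_all add: tot_complex_def)

lemma sum_tot_gens:
  fixes X :: "'g tgen \<Rightarrow> 'a::comm_monoid_add"
  assumes "\<And>i. i \<le> m \<Longrightarrow> finite (gens (F i) j)" "\<And>i. i \<le> m \<Longrightarrow> finite (gens (F i) (j - 1))"
  shows "sum X (tot_gens m F j) = (\<Sum>i\<le>m. \<Sum>g\<in>gens (F i) j. X (Plain i g)) +
    (if j = 0 then 0 else \<Sum>i=1..m. \<Sum>g\<in>gens (F i) (j - 1). X (Shift i g))"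
proof -
  let ?P = "SIGMA i:{..m}. gens (F i) j" and ?S = "SIGMA i:{1..m}. gens (F i) (j - 1)"
  have P: "sum X ((\<lambda>(i, g). Plain i g) ` ?P) = (\<Sum>i\<le>m. \<Sum>g\<in>gens (F i) j. X (Plain i g))"
    using assms(1) by (subst sum.reindex) (auto simp: inj_on_def sum.Sigma case_prod_unfold)
  have S: "sum X ((\<lambda>(i, g). Shift i g) ` ?S) = (\<Sum>i=1..m. \<Sum>g\<in>gens (F i) (j - 1). X (Shift i g))"
    using assms(2) by (subst sum.reindex) (auto simp: inj_on_def sum.Sigma case_prod_unfold)
  have "tot_gens m F j = (\<lambda>(i, g). Plain i g) ` ?P \<union> (if j = 0 then {} else (\<lambda>(i, g). Shift i g) ` ?S)"
    by (auto simp: tot_gens_def image_iff)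
  moreover have "sum X ((\<lambda>(i, g). Plain i g) ` ?P \<union> (\<lambda>(i, g). Shift i g) ` ?S) =
      sum X ((\<lambda>(i, g). Plain i g) ` ?P) + sum X ((\<lambda>(i, g). Shift i g) ` ?S)"
    using assms by (intro sum.union_disjoint finite_imageI finite_SigmaI) auto
  ultimately show ?thesis
    using P S by (cases "j = 0") simp_all
qed

text \<open>The components \<open>a\<^sub>i\<close> and \<open>b\<^sub>i\<close> of an element of \<open>F'\<^sub>j\<close>.\<close>

definition plain_part :: "nat \<Rightarrow> ('g tgen \<Rightarrow> 'a) \<Rightarrow> 'g \<Rightarrow> 'a"
  where "plain_part i z g = z (Plain i g)"

definition shift_part :: "nat \<Rightarrow> ('g tgen \<Rightarrow> 'a) \<Rightarrow> 'g \<Rightarrow> 'a"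
  where "shift_part i z g = z (Shift i g)"

definition from_parts :: "(nat \<Rightarrow> 'g \<Rightarrow> 'a) \<Rightarrow> (nat \<Rightarrow> 'g \<Rightarrow> 'a) \<Rightarrow> 'g tgen \<Rightarrow> 'a"
  where "from_parts a b = case_tgen a b"

lemma parts_from_parts [simp]:
  "plain_part i (from_parts a b) = a i" "shift_part i (from_parts a b) = b i"
  by (auto simp: plain_part_def shift_part_def from_parts_def)

lemma parts_zero [simp]: "plain_part i (\<lambda>_. 0) = (\<lambda>_. 0)" "shift_part i (\<lambda>_. 0) = (\<lambda>_. 0)"
  by (auto simp: plain_part_def shift_part_def)

lemma eq_from_parts: "(\<And>i. plain_part i z = plain_part i w) \<Longrightarrow> (\<And>i. shift_part i z = shift_part i w) \<Longrightarrow> z = w"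
proof (rule ext)
  fix t assume "\<And>i. plain_part i z = plain_part i w" "\<And>i. shift_part i z = shift_part i w"
  then show "z t = w t"
    by (cases t) (auto simp: plain_part_def shift_part_def fun_eq_iff)
qed

lemma chains_tot_complex_iff:
  "z \<in> chains B (tot_complex m F f) j \<longleftrightarrow>
    (\<forall>i. plain_part i z \<in> (if i \<le> m then chains B (F i) j else {\<lambda>_. 0})) \<and>
    (\<forall>i. shift_part i z \<in> (if 1 \<le> j \<and> 1 \<le> i \<and> i \<le> m then chains B (F i) (j - 1) else {\<lambda>_. 0}))"
    (is "?L \<longleftrightarrow> ?R")
proof
  assume ?L
  then show ?R
    by (auto simp: chains_def free_mod_def tot_gens_def plain_part_def shift_part_def fun_eq_iff)
next
  assume R: ?R
  have "t \<in> tot_gens m F j \<longrightarrow> z t \<in> polys B" "t \<notin> tot_gens m F j \<longrightarrow> z t = 0" for t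
  proof -
    have "(t \<in> tot_gens m F j \<longrightarrow> z t \<in> polys B) \<and> (t \<notin> tot_gens m F j \<longrightarrow> z t = 0)"
    proof (cases t)
      case (Plain i g)
      then show ?thesis
        using R[THEN conjunct1, rule_format, of i]
        by (auto simp: chains_def free_mod_def tot_gens_def plain_part_def fun_eq_iff split: if_splits)
    next
      case (Shift i g)
      then show ?thesis
        using R[THEN conjunct2, rule_format, of i]
        by (auto simp: chains_def free_mod_def tot_gens_def shift_part_def fun_eq_iff split: if_splits)
    qed
    then show "t \<in> tot_gens m F j \<longrightarrow> z t \<in> polys B" "t \<notin> tot_gens m F j \<longrightarrow> z t = 0" by auto
  qed
  then show ?L
    by (auto simp: chains_def free_mod_def)
qed

lemma shift_part_outside:
  assumes "z \<in> chains B (tot_complex m F f) j" "i \<notin> {1..m}"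
  shows "shift_part i z = (\<lambda>_. 0)"
proof -
  have "shift_part i z \<in> (if 1 \<le> j \<and> 1 \<le> i \<and> i \<le> m then chains B (F i) (j - 1) else {\<lambda>_. 0})"
    using assms(1) unfolding chains_tot_complex_iff by blast
  moreover have "\<not> (1 \<le> j \<and> 1 \<le> i \<and> i \<le> m)"
    using assms(2) by simp
  ultimately show ?thesis
    by (simp only: if_False singleton_iff)
qed

lemma lifts_inclusion_lin_ext_in_chains:
  "lifts_inclusion A C D f \<Longrightarrow> v \<in> chains A C j \<Longrightarrow> lin_ext (gens C j) (f j) v \<in> chains A D j"
  unfolding chains_def by (rule lin_ext_in_free_mod) (auto simp: lifts_inclusion_def homog_elem_def)

lemma homog_elem_diff:
  fixes v w :: "'g \<Rightarrow> 'k::comm_ring_1 mpoly"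
  assumes "homog_elem B G deg n v" "homog_elem B G deg n w"
  shows "homog_elem B G deg n (\<lambda>g. v g - w g)"
proof -
  have "homog k (q - s)" if "homog k q" "homog k s" for k and q s :: "'k mpoly"
    using that by (fastforce simp: homog_def in_keys_iff lookup_minus)
  then show ?thesis
    using assms by (auto simp: homog_elem_def free_mod_closed)
qed

lemma homog_elem_in_Plain:
  assumes "i \<le> m" "homog_elem B (gens (F i) j) (gdeg (F i) j) (n - (int m - int i)) v"
  shows "homog_elem B (tot_gens m F j) (tot_deg m F j) n (in_Plain i v)"
  using assms
  by (auto simp: homog_elem_def free_mod_def tot_gens_def tot_deg_def in_Plain_def polys_closed homog_zero
      algebra_simps split: tgen.splits)

lemma homog_elem_in_Shift:
  assumes "1 \<le> i" "i \<le> m"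
    and "homog_elem B (gens (F i) j) (gdeg (F i) j) (n - (int m - int i) - 1) v"
  shows "homog_elem B (tot_gens m F (Suc j)) (tot_deg m F (Suc j)) n (in_Shift i v)"
  using assms
  by (auto simp: homog_elem_def free_mod_def tot_gens_def tot_deg_def in_Shift_def polys_closed homog_zero
      algebra_simps split: tgen.splits)

lemma graded_free_tot_complex:
  fixes F :: "nat \<Rightarrow> ('g, 'k::comm_ring_1 mpoly) gcomplex"
  assumes F: "\<And>i. i \<le> m \<Longrightarrow> graded_free B (F i)"
    and f: "\<And>i. i < m \<Longrightarrow> lifts_inclusion B (F (Suc i)) (F i) (f (Suc i))"
    and "0 \<in> B"
  shows "graded_free B (tot_complex m F f)"
  unfolding graded_free_def tot_complex_simps
proof (intro conjI allI ballI)
  have fin: "finite (gens (F i) j)" if "i \<le> m" for i j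
    using F[OF that] by (simp add: graded_free_def)
  show "finite (tot_gens m F j)" for j
  proof -
    have "tot_gens m F j \<subseteq> (\<Union>i\<le>m. Plain i ` gens (F i) j) \<union> (\<Union>i\<le>m. Shift i ` gens (F i) (j - 1))"
      by (auto simp: tot_gens_def)
    then show ?thesis
      by (rule finite_subset) (auto simp: fin)
  qed
  fix t assume t: "t \<in> tot_gens m F 0"
  then obtain i g where t_eq: "t = Plain i g" "i \<le> m" "g \<in> gens (F i) 0"
    by (auto simp: tot_gens_def)
  then have g: "aug (F i) g \<in> polys B" "homog (gdeg (F i) 0 g) (aug (F i) g)"
    using F[of i] by (auto simp: graded_free_def)
  show "tot_aug m F t \<in> polys B"
    using g \<open>0 \<in> B\<close> by (auto simp: t_eq tot_aug_def intro!: mult_in_polys power_in_polys Var_in_polys)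
  show "homog (tot_deg m F 0 t) (tot_aug m F t)"
    using homog_mult[OF homog_Var_power[of "m - i" 0] g(2)] \<open>i \<le> m\<close>
    by (simp add: t_eq tot_deg_def tot_aug_def of_nat_diff add_ac)
next
  fix j t assume t: "t \<in> tot_gens m F (Suc j)"
  have bdry: "homog_elem B (gens (F i) j) (gdeg (F i) j) (gdeg (F i) (Suc j) g) (bdry (F i) (Suc j) g)"
    if "i \<le> m" "g \<in> gens (F i) (Suc j)" for i j g
    using F[OF that(1)] that(2) by (simp add: graded_free_def)
  have lift: "homog_elem B (gens (F i) j) (gdeg (F i) j) (gdeg (F (Suc i)) j g) (f (Suc i) j g)"
    if "i < m" "g \<in> gens (F (Suc i)) j" for i j g
    using f[OF that(1)] that(2) by (simp add: lifts_inclusion_def)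
  show "homog_elem B (tot_gens m F j) (tot_deg m F j) (tot_deg m F (Suc j) t) (tot_bdry F f (Suc j) t)"
  proof (cases t)
    case (Plain i g)
    then have i: "i \<le> m" and g: "g \<in> gens (F i) (Suc j)"
      using t by (auto simp: tot_gens_def)
    from homog_elem_in_Plain[OF i, of B F j "tot_deg m F (Suc j) t"] bdry[OF i g] show ?thesis
      by (simp add: Plain tot_bdry_def tot_deg_def)
  next
    case (Shift i g)
    then obtain i' where i: "i = Suc i'" "i' < m" and g: "g \<in> gens (F (Suc i')) j"
      using t by (cases i) (auto simp: tot_gens_def)
    let ?n = "tot_deg m F (Suc j) t"
    have n: "?n = gdeg (F (Suc i')) j g + (int m - int i')"
      by (simp add: Shift i tot_deg_def)
    have "homog_elem B (gens (F (Suc i')) j) (gdeg (F (Suc i')) j) (gdeg (F (Suc i')) j g + 1)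
        (\<lambda>h. if h = g then Var 0 else 0)"
      using g \<open>0 \<in> B\<close> by (auto simp: homog_elem_def free_mod_def homog_zero homog_Var polys_closed Var_in_polys)
    then have V: "homog_elem B (tot_gens m F j) (tot_deg m F j) ?n (in_Plain i (\<lambda>h. if h = g then Var 0 else 0))"
      using i by (intro homog_elem_in_Plain) (simp_all add: n algebra_simps)
    have L: "homog_elem B (tot_gens m F j) (tot_deg m F j) ?n (in_Plain (i - 1) (f i j g))"
      using i lift[OF i(2) g] by (intro homog_elem_in_Plain) (simp_all add: n)
    have S: "homog_elem B (tot_gens m F j) (tot_deg m F j) ?n
        (if j = 0 then (\<lambda>_. 0) else in_Shift i (bdry (F i) j g))"
    proof (cases j)
      case 0
      then show ?thesis by (simp add: homog_elem_def free_mod_closed homog_zero)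
    next
      case (Suc j')
      then show ?thesis
        using i g bdry[of "Suc i'" g j'] n by (auto intro!: homog_elem_in_Shift)
    qed
    have "tot_bdry F f (Suc j) t = (\<lambda>u. in_Plain i (\<lambda>h. if h = g then Var 0 else 0) u
        - in_Plain (i - 1) (f i j g) u - (if j = 0 then (\<lambda>_. 0) else in_Shift i (bdry (F i) j g)) u)"
      by (auto simp: Shift tot_bdry_def)
    then show ?thesis
      using homog_elem_diff[OF homog_elem_diff[OF V L] S] by simp
  qed
qed

text \<open>The mapping cone argument is carried out over one polynomial ring, which will be \<open>R'\<close>, for
  resolutions \<open>F i\<close> of arbitrary ideals \<open>I i\<close>.\<close>

context
  fixes m :: nat and B :: "nat set"
    and F :: "nat \<Rightarrow> ('g, 'k::comm_ring_1 mpoly) gcomplex"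
    and f :: "nat \<Rightarrow> nat \<Rightarrow> 'g \<Rightarrow> 'g \<Rightarrow> 'k mpoly"
    and I :: "nat \<Rightarrow> 'k mpoly set"
  assumes F: "\<And>i. i \<le> m \<Longrightarrow> graded_free_resolution B (F i) (I i)"
    and f: "\<And>i. i < m \<Longrightarrow> lifts_inclusion B (F (Suc i)) (F i) (f (Suc i))"
begin

abbreviation (input) Tot where "Tot \<equiv> tot_complex m F f"
abbreviation (input) Lift where "Lift i j \<equiv> lin_ext (gens (F i) j) (f i j)"

lemma res_graded_free: "i \<le> m \<Longrightarrow> graded_free B (F i)"
  using F unfolding graded_free_resolution_iff by blast

lemma res_finite: "i \<le> m \<Longrightarrow> finite (gens (F i) j)"
  using res_graded_free by (simp add: graded_free_def)

lemma aug_tot_complex: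
  "aug_map Tot z = (\<Sum>i\<le>m. Var 0 ^ (m - i) * aug_map (F i) (plain_part i z))"
  by (simp add: aug_map_def lin_form_def sum_tot_gens res_finite tot_aug_def plain_part_def
      sum_distrib_left mult_ac)

lemma shift_part_bdry_0: "shift_part i (bdry_map Tot (Suc 0) z) = (\<lambda>_. 0)"
  by (rule ext)
    (simp add: shift_part_def bdry_map_def lin_ext_def sum_tot_gens res_finite tot_bdry_def
      in_Plain_def in_Shift_def)

lemma shift_part_bdry_Suc:
  assumes z: "z \<in> chains B Tot (Suc (Suc j))"
  shows "shift_part i (bdry_map Tot (Suc (Suc j)) z) = (\<lambda>h. - bdry_map (F i) (Suc j) (shift_part i z) h)"
proof (rule ext)
  fix h
  let ?s = "\<lambda>i'. if i' = i then - (\<Sum>g\<in>gens (F i') (Suc j). z (Shift i' g) * bdry (F i') (Suc j) g h) else 0"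
  have "(\<Sum>g\<in>gens (F i') (Suc j). z (Shift i' g) * tot_bdry F f (Suc (Suc j)) (Shift i' g) (Shift i h)) = ?s i'" for i'
    by (simp add: tot_bdry_def in_Plain_def in_Shift_def sum_negf)
  moreover have "tot_bdry F f (Suc (Suc j)) (Plain i' g) (Shift i h) = 0" for i' g
    by (simp add: tot_bdry_def in_Plain_def)
  ultimately have "shift_part i (bdry_map Tot (Suc (Suc j)) z) h = (\<Sum>i'=1..m. ?s i')"
    by (simp add: sum_tot_gens res_finite shift_part_def bdry_map_def lin_ext_def)
  also have "\<dots> = - bdry_map (F i) (Suc j) (shift_part i z) h"
  proof (cases "i \<in> {1..m}")
    case True
    then show ?thesis
      by (simp add: sum.delta bdry_map_def lin_ext_def shift_part_def)
  next
    case False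
    then have "shift_part i z = (\<lambda>_. 0)"
      by (rule shift_part_outside[OF z])
    with False show ?thesis
      by (auto simp: sum.delta bdry_map_linear)
  qed
  finally show "shift_part i (bdry_map Tot (Suc (Suc j)) z) h = - bdry_map (F i) (Suc j) (shift_part i z) h" .
qed

lemma plain_part_bdry:
  assumes z: "z \<in> chains B Tot (Suc j)" and "i \<le> m"
  shows "plain_part i (bdry_map Tot (Suc j) z) =
    (\<lambda>h. bdry_map (F i) (Suc j) (plain_part i z) h + Var 0 * shift_part i z h
       - Lift (Suc i) j (shift_part (Suc i) z) h)"
proof (rule ext)
  fix h
  have 1: "(\<Sum>i'\<le>m. \<Sum>g\<in>gens (F i') (Suc j). z (Plain i' g) * tot_bdry F f (Suc j) (Plain i' g) (Plain i h))
    = bdry_map (F i) (Suc j) (plain_part i z) h"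
  proof -
    have "(\<Sum>g\<in>gens (F i') (Suc j). z (Plain i' g) * tot_bdry F f (Suc j) (Plain i' g) (Plain i h)) =
      (if i' = i then bdry_map (F i) (Suc j) (plain_part i z) h else 0)" for i'
      by (auto simp: tot_bdry_def in_Plain_def bdry_map_def lin_ext_def plain_part_def)
    then show ?thesis
      using \<open>i \<le> m\<close> by simp
  qed
  have 2: "(\<Sum>i'=1..m. \<Sum>g\<in>gens (F i') j. z (Shift i' g) * in_Plain i' (\<lambda>h. if h = g then Var 0 else 0) (Plain i h))
    = Var 0 * shift_part i z h"
  proof -
    have mem: "z (Shift i h) = 0" if "i \<notin> {1..m} \<or> h \<notin> gens (F i) j"
      using z that by (auto simp: chains_def free_mod_def tot_gens_def)
    have "(\<Sum>g\<in>gens (F i') j. z (Shift i' g) * in_Plain i' (\<lambda>h. if h = g then Var 0 else 0) (Plain i h)) =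
      (if i' = i then Var 0 * z (Shift i h) else 0)" if "i' \<in> {1..m}" for i'
      using mem that
      by (auto simp: in_Plain_def if_distrib[of "\<lambda>x. _ * x"] res_finite mult.commute cong: if_cong)
    then have "(\<Sum>i'=1..m. \<Sum>g\<in>gens (F i') j. z (Shift i' g) * in_Plain i' (\<lambda>h. if h = g then Var 0 else 0) (Plain i h))
      = (\<Sum>i'=1..m. if i' = i then Var 0 * z (Shift i h) else 0)"
      by (intro sum.cong refl) simp
    then show ?thesis
      using mem by (auto simp: shift_part_def)
  qed
  have 3: "(\<Sum>i'=1..m. \<Sum>g\<in>gens (F i') j. z (Shift i' g) * in_Plain (i' - 1) (f i' j g) (Plain i h))
    = Lift (Suc i) j (shift_part (Suc i) z) h"
  proof -
    have "(\<Sum>g\<in>gens (F i') j. z (Shift i' g) * in_Plain (i' - 1) (f i' j g) (Plain i h)) =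
      (if i' = Suc i then Lift (Suc i) j (shift_part (Suc i) z) h else 0)" if "i' \<in> {1..m}" for i'
      using that by (cases i') (auto simp: in_Plain_def lin_ext_def shift_part_def)
    then have "(\<Sum>i'=1..m. \<Sum>g\<in>gens (F i') j. z (Shift i' g) * in_Plain (i' - 1) (f i' j g) (Plain i h))
      = (\<Sum>i'=1..m. if i' = Suc i then Lift (Suc i) j (shift_part (Suc i) z) h else 0)"
      by (intro sum.cong refl) simp
    moreover have "shift_part (Suc i) z = (\<lambda>_. 0)" if "Suc i \<notin> {1..m}"
      using that by (rule shift_part_outside[OF z])
    ultimately show ?thesis
      by auto
  qed
  have "plain_part i (bdry_map Tot (Suc j) z) h =
      (\<Sum>i'\<le>m. \<Sum>g\<in>gens (F i') (Suc j). z (Plain i' g) * tot_bdry F f (Suc j) (Plain i' g) (Plain i h)) +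
      (\<Sum>i'=1..m. \<Sum>g\<in>gens (F i') j. z (Shift i' g) * tot_bdry F f (Suc j) (Shift i' g) (Plain i h))"
    by (simp add: plain_part_def bdry_map_def lin_ext_def sum_tot_gens res_finite)
  also have "(\<Sum>i'=1..m. \<Sum>g\<in>gens (F i') j. z (Shift i' g) * tot_bdry F f (Suc j) (Shift i' g) (Plain i h)) =
    (\<Sum>i'=1..m. \<Sum>g\<in>gens (F i') j. z (Shift i' g) * in_Plain i' (\<lambda>h. if h = g then Var 0 else 0) (Plain i h)) -
    (\<Sum>i'=1..m. \<Sum>g\<in>gens (F i') j. z (Shift i' g) * in_Plain (i' - 1) (f i' j g) (Plain i h))"
    by (simp add: tot_bdry_def in_Shift_def right_diff_distrib sum_subtractf cong: if_cong)
  finally show "plain_part i (bdry_map Tot (Suc j) z) h =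
    bdry_map (F i) (Suc j) (plain_part i z) h + Var 0 * shift_part i z h - Lift (Suc i) j (shift_part (Suc i) z) h"
    unfolding 1 2 3 by simp
qed


lemma res_exact_0:
  assumes "i \<le> m" "v \<in> chains B (F i) 0" "aug_map (F i) v = 0"
  obtains w where "w \<in> chains B (F i) (Suc 0)" "bdry_map (F i) (Suc 0) w = v"
proof -
  have "v \<in> bdry_map (F i) (Suc 0) ` chains B (F i) (Suc 0)"
    using F[OF assms(1)] assms(2,3) unfolding graded_free_resolution_iff by simp
  then show ?thesis
    using that by blast
qed

lemma res_exact_Suc:
  assumes "i \<le> m" "v \<in> chains B (F i) (Suc j)" "bdry_map (F i) (Suc j) v = (\<lambda>_. 0)"
  obtains w where "w \<in> chains B (F i) (Suc (Suc j))" "bdry_map (F i) (Suc (Suc j)) w = v"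
proof -
  have "v \<in> bdry_map (F i) (Suc (Suc j)) ` chains B (F i) (Suc (Suc j))"
    using F[OF assms(1)] assms(2,3) unfolding graded_free_resolution_iff by simp
  then show ?thesis
    using that by blast
qed

lemma res_aug_bdry: "i \<le> m \<Longrightarrow> v \<in> chains B (F i) (Suc 0) \<Longrightarrow> aug_map (F i) (bdry_map (F i) (Suc 0) v) = 0"
  using F[of i] unfolding graded_free_resolution_iff by blast

lemma res_bdry_bdry:
  "i \<le> m \<Longrightarrow> v \<in> chains B (F i) (Suc (Suc j)) \<Longrightarrow>
    bdry_map (F i) (Suc j) (bdry_map (F i) (Suc (Suc j)) v) = (\<lambda>_. 0)"
  using F[of i] unfolding graded_free_resolution_iff by blast

lemma res_aug_image: "i \<le> m \<Longrightarrow> aug_map (F i) ` chains B (F i) 0 = I i"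
  using F unfolding graded_free_resolution_iff by blast

lemma res_ideal_obtain:
  assumes "i \<le> m" "q \<in> I i"
  obtains v where "v \<in> chains B (F i) 0" "aug_map (F i) v = q"
proof -
  have "q \<in> aug_map (F i) ` chains B (F i) 0"
    using assms res_aug_image[of i] by simp
  then show ?thesis
    using that by auto
qed

lemma lift_chains: "i < m \<Longrightarrow> v \<in> chains B (F (Suc i)) j \<Longrightarrow> Lift (Suc i) j v \<in> chains B (F i) j"
  using f by (rule lifts_inclusion_lin_ext_in_chains)

lemma lift_bdry: "i < m \<Longrightarrow> v \<in> chains B (F (Suc i)) (Suc j) \<Longrightarrow>
    bdry_map (F i) (Suc j) (Lift (Suc i) (Suc j) v) = Lift (Suc i) j (bdry_map (F (Suc i)) (Suc j) v)"
  using f by (simp add: lifts_inclusion_def)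

lemma lift_aug: "i < m \<Longrightarrow> v \<in> chains B (F (Suc i)) 0 \<Longrightarrow>
    aug_map (F i) (Lift (Suc i) 0 v) = aug_map (F (Suc i)) v"
  using f by (simp add: lifts_inclusion_def)

text \<open>That the lifts \<open>f\<close> exist already forces \<open>I i\<close> to decrease.\<close>

lemma res_ideal_antimono:
  assumes "i < m"
  shows "I (Suc i) \<subseteq> I i"
proof
  fix q assume "q \<in> I (Suc i)"
  then obtain v where v: "v \<in> chains B (F (Suc i)) 0" "q = aug_map (F (Suc i)) v"
    using res_aug_image[of "Suc i"] assms by auto
  then show "q \<in> I i"
    using lift_aug[OF assms v(1)] lift_chains[OF assms v(1)] res_aug_image[of i] assms by force
qed

lemma res_ideal_add:
  assumes "i \<le> m" "q \<in> I i" "s \<in> I i"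
  shows "q + s \<in> I i"
proof -
  obtain v where v: "v \<in> chains B (F i) 0" "aug_map (F i) v = q"
    using res_ideal_obtain[OF assms(1,2)] .
  obtain w where w: "w \<in> chains B (F i) 0" "aug_map (F i) w = s"
    using res_ideal_obtain[OF assms(1,3)] .
  note eq = v(2) w(2)
  have "(\<lambda>g. v g + w g) \<in> chains B (F i) 0"
    using v(1) w(1) by (simp add: chains_def free_mod_closed)
  then show ?thesis
    unfolding eq[symmetric] aug_map_linear(2)[symmetric] using res_aug_image[OF assms(1)] by blast
qed

lemma part_chains:
  assumes "z \<in> chains B Tot j"
  shows "i \<le> m \<Longrightarrow> plain_part i z \<in> chains B (F i) j"
    and "m < i \<Longrightarrow> plain_part i z = (\<lambda>_. 0)"
    and "j = Suc j' \<Longrightarrow> i \<le> m \<Longrightarrow> shift_part i z \<in> chains B (F i) j'"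
proof -
  have P: "plain_part i z \<in> (if i \<le> m then chains B (F i) j else {\<lambda>_. 0})"
    and S: "shift_part i z \<in> (if 1 \<le> j \<and> 1 \<le> i \<and> i \<le> m then chains B (F i) (j - 1) else {\<lambda>_. 0})"
    using assms unfolding chains_tot_complex_iff by blast+
  show "i \<le> m \<Longrightarrow> plain_part i z \<in> chains B (F i) j" "m < i \<Longrightarrow> plain_part i z = (\<lambda>_. 0)"
    using P by simp_all
  show "shift_part i z \<in> chains B (F i) j'" if "j = Suc j'" "i \<le> m"
  proof (cases "1 \<le> i")
    case True
    then show ?thesis using S that by simp
  next
    case False
    then have "shift_part i z = (\<lambda>_. 0)"
      by (intro shift_part_outside[OF assms]) simp
    then show ?thesis
      by (simp add: chains_def free_mod_closed)
  qed
qed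


section \<open>Exactness of \<open>F'\<close>\<close>

text \<open>Exactness at \<open>F'\<^sub>0\<close> depends on \<open>x\<^sub>0\<close> being a nonzerodivisor modulo each \<open>I i\<close>.\<close>

context
  assumes zero: "0 \<in> B"
    and saturated: "\<And>i q. i \<le> m \<Longrightarrow> q \<in> polys B \<Longrightarrow> Var 0 * q \<in> I i \<Longrightarrow> q \<in> I i"
begin

lemma tot_complex_graded_free: "graded_free B Tot"
  using graded_free_tot_complex res_graded_free f zero by blast

text \<open>With \<open>\<beta>\<^sub>i\<close> the augmentation of \<open>b\<^sub>i\<close>, a boundary has components of augmentation
  \<open>x\<^sub>0 \<beta>\<^sub>i - \<beta>\<^sub>i\<^sub>+\<^sub>1\<close>.  This makes the augmentation of a boundary telescope to zero, and also controls
  the cycles in degree 1.\<close>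

lemma aug_plain_part_bdry:
  assumes z: "z \<in> chains B Tot (Suc 0)" and i: "i \<le> m"
  shows "aug_map (F i) (plain_part i (bdry_map Tot (Suc 0) z)) =
    Var 0 * aug_map (F i) (shift_part i z) - aug_map (F (Suc i)) (shift_part (Suc i) z)"
proof -
  have "aug_map (F i) (Lift (Suc i) 0 (shift_part (Suc i) z)) = aug_map (F (Suc i)) (shift_part (Suc i) z)"
  proof (cases "i = m")
    case True
    then show ?thesis
      using shift_part_outside[OF z, of "Suc i"] by (simp add: aug_map_linear)
  next
    case False
    then show ?thesis
      using i part_chains(3)[OF z, of 0 "Suc i"] by (intro lift_aug) auto
  qed
  then show ?thesis
    by (simp add: plain_part_bdry[OF z i] aug_map_linear res_aug_bdry[OF i part_chains(1)[OF z i]])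
qed

lemma bdry_plain_part_bdry:
  assumes z: "z \<in> chains B Tot (Suc (Suc j))" and i: "i \<le> m"
  shows "bdry_map (F i) (Suc j) (plain_part i (bdry_map Tot (Suc (Suc j)) z)) =
    (\<lambda>h. Var 0 * bdry_map (F i) (Suc j) (shift_part i z) h
      - Lift (Suc i) j (bdry_map (F (Suc i)) (Suc j) (shift_part (Suc i) z)) h)"
proof -
  have "bdry_map (F i) (Suc j) (Lift (Suc i) (Suc j) (shift_part (Suc i) z)) =
    Lift (Suc i) j (bdry_map (F (Suc i)) (Suc j) (shift_part (Suc i) z))"
  proof (cases "i = m")
    case True
    then show ?thesis
      using shift_part_outside[OF z, of "Suc i"] by (simp add: bdry_map_linear)
  next
    case False
    then show ?thesis
      using i part_chains(3)[OF z, of "Suc j" "Suc i"] by (intro lift_bdry) auto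
  qed
  then show ?thesis
    by (simp add: plain_part_bdry[OF z i] bdry_map_linear res_bdry_bdry[OF i part_chains(1)[OF z i]])
qed

lemma aug_bdry_tot_complex:
  assumes z: "z \<in> chains B Tot (Suc 0)"
  shows "aug_map Tot (bdry_map Tot (Suc 0) z) = 0"
proof -
  let ?b = "\<lambda>i. aug_map (F i) (shift_part i z)"
  have "aug_map Tot (bdry_map Tot (Suc 0) z) =
      (\<Sum>i\<le>m. Var 0 ^ (m - i) * (Var 0 * ?b i - ?b (Suc i)))"
    by (simp add: aug_tot_complex aug_plain_part_bdry[OF z] cong: sum.cong_simp)
  also have "\<dots> = (\<Sum>i\<le>m. Var 0 ^ (Suc m - i) * ?b i - Var 0 ^ (Suc m - Suc i) * ?b (Suc i))"
    by (intro sum.cong refl) (simp add: Suc_diff_le right_diff_distrib mult_ac)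
  also have "\<dots> = Var 0 ^ (Suc m - 0) * ?b 0 - Var 0 ^ (Suc m - Suc m) * ?b (Suc m)"
    by (rule sum_telescope)
  also have "\<dots> = 0"
    using shift_part_outside[OF z, of 0] shift_part_outside[OF z, of "Suc m"] by (simp add: aug_map_linear)
  finally show ?thesis .
qed

lemma bdry_bdry_tot_complex:
  assumes z: "z \<in> chains B Tot (Suc (Suc j))"
  shows "bdry_map Tot (Suc j) (bdry_map Tot (Suc (Suc j)) z) = (\<lambda>_. 0)"
proof (rule eq_from_parts)
  let ?z = "bdry_map Tot (Suc (Suc j)) z"
  have z': "?z \<in> chains B Tot (Suc j)"
    using bdry_map_in_chains[OF tot_complex_graded_free z] .
  have z'': "bdry_map Tot (Suc j) ?z \<in> chains B Tot j"
    using bdry_map_in_chains[OF tot_complex_graded_free z'] .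
  fix i
  show "plain_part i (bdry_map Tot (Suc j) ?z) = plain_part i (\<lambda>_. 0)"
  proof (cases "i \<le> m")
    case True
    then show ?thesis
      by (simp add: plain_part_bdry[OF z'] bdry_plain_part_bdry[OF z] shift_part_bdry_Suc[OF z]
          lin_ext_uminus)
  next
    case False
    then show ?thesis
      using part_chains(2)[OF z'', of i] by (simp add: plain_part_def fun_eq_iff)
  qed
  show "shift_part i (bdry_map Tot (Suc j) ?z) = shift_part i (\<lambda>_. 0)"
  proof (cases "\<exists>j'. j = Suc j' \<and> i \<in> {1..m}")
    case True
    then obtain j' where j: "j = Suc j'" "i \<le> m" by auto
    then show ?thesis
      using z z' part_chains(3)[OF z, of "Suc j" i]
      by (simp add: shift_part_bdry_Suc bdry_map_linear res_bdry_bdry)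
  next
    case False
    then show ?thesis
      using shift_part_bdry_0[of i ?z] shift_part_outside[OF z'', of i]
      by (cases j) auto
  qed
qed

text \<open>The step common to all degrees: given \<open>b'\<close>, written \<open>b\<close> here, it remains to solve for the
  components \<open>a'\<close> one index at a time.\<close>

lemma boundary_from_parts:
  assumes z: "z \<in> chains B Tot j"
    and b: "\<And>i. b i \<in> (if 1 \<le> i \<and> i \<le> m then chains B (F i) j else {\<lambda>_. 0})"
    and b_bdry: "\<And>j' i. j = Suc j' \<Longrightarrow> bdry_map (F i) j (b i) = (\<lambda>h. - shift_part i z h)"
    and e: "\<And>i. i \<le> m \<Longrightarrow> \<exists>w\<in>chains B (F i) (Suc j). bdry_map (F i) (Suc j) w =
      (\<lambda>h. plain_part i z h - Var 0 * b i h + Lift (Suc i) j (b (Suc i)) h)"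
  shows "z \<in> bdry_map Tot (Suc j) ` chains B Tot (Suc j)"
proof -
  have "\<forall>i\<in>{..m}. \<exists>w. w \<in> chains B (F i) (Suc j) \<and> bdry_map (F i) (Suc j) w =
      (\<lambda>h. plain_part i z h - Var 0 * b i h + Lift (Suc i) j (b (Suc i)) h)"
    using e by blast
  from bchoice[OF this] obtain a where a: "\<And>i. i \<le> m \<Longrightarrow> a i \<in> chains B (F i) (Suc j)"
    and a_bdry: "\<And>i. i \<le> m \<Longrightarrow> bdry_map (F i) (Suc j) (a i) =
      (\<lambda>h. plain_part i z h - Var 0 * b i h + Lift (Suc i) j (b (Suc i)) h)"
    by auto
  define w where "w = from_parts (\<lambda>i. if i \<le> m then a i else (\<lambda>_. 0)) b"
  have w: "w \<in> chains B Tot (Suc j)"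
    unfolding chains_tot_complex_iff
  proof (intro conjI allI)
    fix i
    show "plain_part i w \<in> (if i \<le> m then chains B (F i) (Suc j) else {\<lambda>_. 0})"
      using a by (simp add: w_def)
    show "shift_part i w \<in>
        (if 1 \<le> Suc j \<and> 1 \<le> i \<and> i \<le> m then chains B (F i) (Suc j - 1) else {\<lambda>_. 0})"
      using b[of i] by (cases "1 \<le> i \<and> i \<le> m") (auto simp: w_def)
  qed
  have bw: "bdry_map Tot (Suc j) w \<in> chains B Tot j"
    using bdry_map_in_chains[OF tot_complex_graded_free w] .
  have "bdry_map Tot (Suc j) w = z"
  proof (rule eq_from_parts)
    fix i
    show "plain_part i (bdry_map Tot (Suc j) w) = plain_part i z"
    proof (cases "i \<le> m")
      case True
      then show ?thesis
        unfolding plain_part_bdry[OF w True] by (simp add: w_def a_bdry)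
    next
      case False
      then show ?thesis
        using part_chains(2)[OF z, of i] part_chains(2)[OF bw, of i] by simp
    qed
    show "shift_part i (bdry_map Tot (Suc j) w) = shift_part i z"
    proof (cases j)
      case 0
      have "shift_part i z = (\<lambda>_. 0)"
        using z by (simp add: chains_tot_complex_iff 0)
      then show ?thesis
        by (simp add: 0 shift_part_bdry_0)
    next
      case (Suc j')
      then show ?thesis
        using b_bdry[of j' i] unfolding Suc shift_part_bdry_Suc[OF w[unfolded Suc]] by (simp add: w_def)
    qed
  qed
  then show ?thesis
    using w by blast
qed

lemma exact_tot_complex_Suc:
  assumes z: "z \<in> chains B Tot (Suc j)" "bdry_map Tot (Suc j) z = (\<lambda>_. 0)"
  shows "z \<in> bdry_map Tot (Suc (Suc j)) ` chains B Tot (Suc (Suc j))"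
proof -
  have plain: "bdry_map (F i) (Suc j) (plain_part i z) h + Var 0 * shift_part i z h
       - Lift (Suc i) j (shift_part (Suc i) z) h = 0" if "i \<le> m" for i h
    using plain_part_bdry[OF z(1) that] unfolding z(2) by (simp add: plain_part_def fun_eq_iff)
  have "\<exists>b. b \<in> (if 1 \<le> i \<and> i \<le> m then chains B (F i) (Suc j) else {\<lambda>_. 0}) \<and>
      bdry_map (F i) (Suc j) b = (\<lambda>h. - shift_part i z h)" for i
  proof (cases "1 \<le> i \<and> i \<le> m")
    case True
    have mem: "shift_part i z \<in> chains B (F i) j"
      using part_chains(3)[OF z(1)] True by simp
    then have mem': "(\<lambda>h. - shift_part i z h) \<in> chains B (F i) j"
      by (simp add: chains_def free_mod_closed)
    have "\<exists>b\<in>chains B (F i) (Suc j). bdry_map (F i) (Suc j) b = (\<lambda>h. - shift_part i z h)"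
    proof (cases j)
      case 0
      \<comment> \<open>In degree 1 the cycle condition reads \<open>\<beta>\<^sub>i\<^sub>+\<^sub>1 = x\<^sub>0 \<beta>\<^sub>i\<close>, starting from \<open>\<beta>\<^sub>0 = 0\<close>.\<close>
      have *: "i' \<le> Suc m \<Longrightarrow> aug_map (F i') (shift_part i' z) = 0" for i'
      proof (induction i')
        case 0
        then show ?case
          using shift_part_outside[OF z(1), of 0] by (simp add: aug_map_linear)
      next
        case (Suc i')
        have "aug_map (F i') (plain_part i' (bdry_map Tot (Suc 0) z)) = 0"
          using z(2) by (simp add: \<open>j = 0\<close> aug_map_linear)
        then show ?case
          using aug_plain_part_bdry[of z i'] z(1) Suc by (simp add: \<open>j = 0\<close>)
      qed
      have "aug_map (F i) (\<lambda>h. - shift_part i z h) = 0"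
        using *[of i] True aug_map_linear(4)[of "F i" "-1" "shift_part i z"] by simp
      with True mem' show ?thesis
        using res_exact_0[of i "\<lambda>h. - shift_part i z h"] unfolding 0 by blast
    next
      case (Suc j')
      have "(\<lambda>h. - bdry_map (F i) (Suc j') (shift_part i z) h) = (\<lambda>_. 0)"
        using z shift_part_bdry_Suc[of z j' i] unfolding Suc by (simp add: shift_part_def)
      then have "bdry_map (F i) (Suc j') (\<lambda>h. - shift_part i z h) = (\<lambda>_. 0)"
        by (simp add: bdry_map_linear)
      with True mem' show ?thesis
        using res_exact_Suc[of i "\<lambda>h. - shift_part i z h" j'] unfolding Suc by blast
    qed
    then show ?thesis
      using True by auto
  next
    case False
    then have "shift_part i z = (\<lambda>_. 0)"
      by (intro shift_part_outside[OF z(1)]) auto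
    then show ?thesis
      using False by (auto simp: bdry_map_linear)
  qed
  then have "\<exists>b. \<forall>i. b i \<in> (if 1 \<le> i \<and> i \<le> m then chains B (F i) (Suc j) else {\<lambda>_. 0}) \<and>
      bdry_map (F i) (Suc j) (b i) = (\<lambda>h. - shift_part i z h)"
    by (intro choice allI)
  then obtain b
    where b: "\<And>i. b i \<in> (if 1 \<le> i \<and> i \<le> m then chains B (F i) (Suc j) else {\<lambda>_. 0})"
      and b_bdry: "\<And>i. bdry_map (F i) (Suc j) (b i) = (\<lambda>h. - shift_part i z h)"
    by blast
  have b_chains: "b i \<in> chains B (F i) (Suc j)" if "i \<le> m" for i
    using b[of i] that by (auto simp: chains_def free_mod_closed split: if_splits)
  have L_b: "Lift (Suc i) (Suc j) (b (Suc i)) \<in> chains B (F i) (Suc j)"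
    "bdry_map (F i) (Suc j) (Lift (Suc i) (Suc j) (b (Suc i))) = (\<lambda>h. - Lift (Suc i) j (shift_part (Suc i) z) h)"
    if "i \<le> m" for i
  proof -
    have "Lift (Suc i) (Suc j) (b (Suc i)) \<in> chains B (F i) (Suc j) \<and>
      bdry_map (F i) (Suc j) (Lift (Suc i) (Suc j) (b (Suc i))) = Lift (Suc i) j (bdry_map (F (Suc i)) (Suc j) (b (Suc i)))"
    proof (cases "i = m")
      case True
      then show ?thesis
        using b[of "Suc i"] by (simp add: chains_def free_mod_closed bdry_map_linear)
    next
      case False
      then show ?thesis
        using that b_chains[of "Suc i"] lift_bdry lift_chains by simp
    qed
    then show "Lift (Suc i) (Suc j) (b (Suc i)) \<in> chains B (F i) (Suc j)"
      "bdry_map (F i) (Suc j) (Lift (Suc i) (Suc j) (b (Suc i))) = (\<lambda>h. - Lift (Suc i) j (shift_part (Suc i) z) h)"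
      by (simp_all add: b_bdry lin_ext_uminus)
  qed
  show ?thesis
  proof (rule boundary_from_parts[OF z(1) b])
    fix i assume i: "i \<le> m"
    let ?e = "\<lambda>h. plain_part i z h - Var 0 * b i h + Lift (Suc i) (Suc j) (b (Suc i)) h"
    have e_chains: "?e \<in> chains B (F i) (Suc j)"
      using part_chains(1)[OF z(1) i] b_chains[OF i] L_b(1)[OF i] zero
      unfolding chains_def by (intro free_mod_closed Var_in_polys)
    have e_bdry: "bdry_map (F i) (Suc j) ?e = (\<lambda>_. 0)"
      using plain[OF i] by (simp add: bdry_map_linear b_bdry L_b(2)[OF i])
    show "\<exists>w\<in>chains B (F i) (Suc (Suc j)). bdry_map (F i) (Suc (Suc j)) w = ?e"
      by (rule res_exact_Suc[OF i e_chains e_bdry]) blast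
  qed (use b_bdry in auto)
qed

text \<open>The recursion \<open>\<beta>\<^sub>i\<^sub>+\<^sub>1 = x\<^sub>0 \<beta>\<^sub>i - \<alpha>\<^sub>i\<close> from \<open>\<beta>\<^sub>0 = 0\<close> defines \<open>\<beta>\<close>, and the hypothesis on the sum says
  that it ends with \<open>\<beta>\<^sub>m\<^sub>+\<^sub>1 = 0\<close>.  Membership comes from the other end: if \<open>\<beta>\<^sub>i\<^sub>+\<^sub>1\<close> lies in \<open>I (i + 1)\<close>,
  then \<open>x\<^sub>0 \<beta>\<^sub>i = \<alpha>\<^sub>i + \<beta>\<^sub>i\<^sub>+\<^sub>1\<close> lies in \<open>I i\<close>, and \<open>x\<^sub>0\<close> can be cancelled.\<close>

lemma telescope_in_ideals:
  fixes \<alpha> :: "nat \<Rightarrow> 'k mpoly"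
  assumes \<alpha>: "\<And>i. i \<le> m \<Longrightarrow> \<alpha> i \<in> I i" "\<And>i. i \<le> m \<Longrightarrow> \<alpha> i \<in> polys B"
    and sum: "(\<Sum>i\<le>m. Var 0 ^ (m - i) * \<alpha> i) = 0"
  obtains \<beta> where "\<beta> 0 = 0" "\<beta> (Suc m) = 0" "\<And>i. i \<le> m \<Longrightarrow> \<beta> i \<in> I i"
    "\<And>i. i \<le> m \<Longrightarrow> Var 0 * \<beta> i - \<beta> (Suc i) = \<alpha> i"
proof -
  define \<beta> where "\<beta> i = - (\<Sum>l<i. Var 0 ^ (i - Suc l) * \<alpha> l)" for i
  have step: "Var 0 * \<beta> i - \<beta> (Suc i) = \<alpha> i" for i
  proof -
    have "Var 0 * (\<Sum>l<i. Var 0 ^ (i - Suc l) * \<alpha> l) = (\<Sum>l<i. Var 0 ^ (i - l) * \<alpha> l)"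
      unfolding sum_distrib_left
    proof (rule sum.cong[OF refl])
      fix l assume "l \<in> {..<i}"
      then have "i - l = Suc (i - Suc l)" by simp
      then show "Var 0 * (Var 0 ^ (i - Suc l) * \<alpha> l) = Var 0 ^ (i - l) * \<alpha> l"
        by (simp only: power_Suc mult.assoc)
    qed
    then show ?thesis
      by (simp add: \<beta>_def)
  qed
  have last: "\<beta> (Suc m) = 0"
    using sum by (simp add: \<beta>_def lessThan_Suc_atMost)
  have polys: "\<beta> i \<in> polys B" if "i \<le> Suc m" for i
    unfolding \<beta>_def using that zero
    by (intro uminus_in_polys sum_in_polys mult_in_polys power_in_polys Var_in_polys \<alpha>(2)) auto
  have "\<beta> i \<in> I i" if "i \<le> m" for i
    using that
  proof (induction rule: inc_induct)
    case base
    have "Var 0 * \<beta> m = \<alpha> m"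
      using step[of m] last by simp
    then show ?case
      using saturated[of m "\<beta> m"] polys[of m] \<alpha>(1)[of m] by simp
  next
    case (step i)
    have "Var 0 * \<beta> i = \<alpha> i + \<beta> (Suc i)"
      using \<open>Var 0 * \<beta> i - \<beta> (Suc i) = \<alpha> i\<close> by (simp add: algebra_simps)
    moreover have "\<alpha> i + \<beta> (Suc i) \<in> I i"
      using step \<alpha>(1)[of i] res_ideal_antimono[of i] by (intro res_ideal_add) auto
    ultimately show ?case
      using saturated[of i "\<beta> i"] polys[of i] step by simp
  qed
  moreover have "\<beta> 0 = 0"
    by (simp add: \<beta>_def)
  ultimately show ?thesis
    using step last that by blast
qed

lemma exact_tot_complex_0:
  assumes z: "z \<in> chains B Tot 0" "aug_map Tot z = 0"
  shows "z \<in> bdry_map Tot (Suc 0) ` chains B Tot (Suc 0)"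
proof -
  obtain \<beta> where \<beta>: "\<beta> 0 = 0" "\<beta> (Suc m) = 0" "\<And>i. i \<le> m \<Longrightarrow> \<beta> i \<in> I i"
    "\<And>i. i \<le> m \<Longrightarrow> Var 0 * \<beta> i - \<beta> (Suc i) = aug_map (F i) (plain_part i z)"
  proof (rule telescope_in_ideals[of "\<lambda>i. aug_map (F i) (plain_part i z)"])
    fix i assume i: "i \<le> m"
    show "aug_map (F i) (plain_part i z) \<in> I i"
      using part_chains(1)[OF z(1) i] res_aug_image[OF i] by blast
    show "aug_map (F i) (plain_part i z) \<in> polys B"
      using part_chains(1)[OF z(1) i] res_graded_free[OF i] by (rule aug_map_in_polys[rotated])
  qed (use z(2) aug_tot_complex in auto)
  have "\<exists>b. b \<in> (if 1 \<le> i \<and> i \<le> m then chains B (F i) 0 else {\<lambda>_. 0}) \<and>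
      (i \<le> Suc m \<longrightarrow> aug_map (F i) b = \<beta> i)" for i
  proof (cases "1 \<le> i \<and> i \<le> m")
    case True
    then show ?thesis
      using res_ideal_obtain[of i "\<beta> i"] \<beta>(3)[of i] by auto
  next
    case False
    then have "i \<le> Suc m \<Longrightarrow> \<beta> i = 0"
      using \<beta>(1,2) by (cases "i = 0"; cases "i = Suc m") auto
    then show ?thesis
      using False by (auto simp: aug_map_linear)
  qed
  then have "\<exists>b. \<forall>i. b i \<in> (if 1 \<le> i \<and> i \<le> m then chains B (F i) 0 else {\<lambda>_. 0}) \<and>
      (i \<le> Suc m \<longrightarrow> aug_map (F i) (b i) = \<beta> i)"
    by (intro choice allI)
  then obtain b
    where b: "\<And>i. b i \<in> (if 1 \<le> i \<and> i \<le> m then chains B (F i) 0 else {\<lambda>_. 0})"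
      and b_aug: "\<And>i. i \<le> Suc m \<Longrightarrow> aug_map (F i) (b i) = \<beta> i"
    by blast
  have b_chains: "b i \<in> chains B (F i) 0" if "i \<le> m" for i
    using b[of i] that by (auto simp: chains_def free_mod_closed split: if_splits)
  have L_b: "Lift (Suc i) 0 (b (Suc i)) \<in> chains B (F i) 0" "aug_map (F i) (Lift (Suc i) 0 (b (Suc i))) = \<beta> (Suc i)"
    if "i \<le> m" for i
  proof -
    have "Lift (Suc i) 0 (b (Suc i)) \<in> chains B (F i) 0 \<and> aug_map (F i) (Lift (Suc i) 0 (b (Suc i))) = \<beta> (Suc i)"
    proof (cases "i = m")
      case True
      then show ?thesis
        using b[of "Suc i"] \<beta>(2) by (simp add: chains_def free_mod_closed aug_map_linear)
    next
      case False
      then show ?thesis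
        using that b_chains[of "Suc i"] b_aug[of "Suc i"] lift_aug lift_chains by simp
    qed
    then show "Lift (Suc i) 0 (b (Suc i)) \<in> chains B (F i) 0" "aug_map (F i) (Lift (Suc i) 0 (b (Suc i))) = \<beta> (Suc i)"
      by simp_all
  qed
  show ?thesis
  proof (rule boundary_from_parts[OF z(1) b])
    fix i assume i: "i \<le> m"
    let ?e = "\<lambda>h. plain_part i z h - Var 0 * b i h + Lift (Suc i) 0 (b (Suc i)) h"
    have e_chains: "?e \<in> chains B (F i) 0"
      using part_chains(1)[OF z(1) i] b_chains[OF i] L_b(1)[OF i] zero
      unfolding chains_def by (intro free_mod_closed Var_in_polys)
    have e_aug: "aug_map (F i) ?e = 0"
      using \<beta>(4)[OF i] b_aug[of i] i by (simp add: aug_map_linear L_b(2)[OF i] algebra_simps)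
    show "\<exists>w\<in>chains B (F i) (Suc 0). bdry_map (F i) (Suc 0) w = ?e"
      by (rule res_exact_0[OF i e_chains e_aug]) blast
  qed auto
qed

lemma aug_image_tot_complex:
  "aug_map Tot ` chains B Tot 0 = {q. \<exists>\<alpha>. (\<forall>i\<le>m. \<alpha> i \<in> I i) \<and> q = (\<Sum>i\<le>m. Var 0 ^ (m - i) * \<alpha> i)}"
proof (intro equalityI subsetI)
  fix q assume "q \<in> aug_map Tot ` chains B Tot 0"
  then obtain z where z: "z \<in> chains B Tot 0" "q = aug_map Tot z" by blast
  have "aug_map (F i) (plain_part i z) \<in> I i" if "i \<le> m" for i
    using part_chains(1)[OF z(1) that] res_aug_image[OF that] by blast
  then show "q \<in> {q. \<exists>\<alpha>. (\<forall>i\<le>m. \<alpha> i \<in> I i) \<and> q = (\<Sum>i\<le>m. Var 0 ^ (m - i) * \<alpha> i)}"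
    unfolding z(2) aug_tot_complex mem_Collect_eq
    by (intro exI[of _ "\<lambda>i. aug_map (F i) (plain_part i z)"]) simp
next
  fix q assume "q \<in> {q. \<exists>\<alpha>. (\<forall>i\<le>m. \<alpha> i \<in> I i) \<and> q = (\<Sum>i\<le>m. Var 0 ^ (m - i) * \<alpha> i)}"
  then obtain \<alpha> where \<alpha>: "\<And>i. i \<le> m \<Longrightarrow> \<alpha> i \<in> I i" "q = (\<Sum>i\<le>m. Var 0 ^ (m - i) * \<alpha> i)" by blast
  have "\<forall>i\<in>{..m}. \<exists>a. a \<in> chains B (F i) 0 \<and> aug_map (F i) a = \<alpha> i"
  proof
    fix i assume "i \<in> {..m}"
    then have "i \<le> m" by simp
    from res_ideal_obtain[OF this \<alpha>(1)[OF this]] show "\<exists>a. a \<in> chains B (F i) 0 \<and> aug_map (F i) a = \<alpha> i"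
      by blast
  qed
  from bchoice[OF this] obtain a
    where a: "\<And>i. i \<le> m \<Longrightarrow> a i \<in> chains B (F i) 0" "\<And>i. i \<le> m \<Longrightarrow> aug_map (F i) (a i) = \<alpha> i"
    by auto
  define z where "z = from_parts (\<lambda>i. if i \<le> m then a i else (\<lambda>_. 0)) (\<lambda>_ _. 0)"
  have "z \<in> chains B Tot 0"
    unfolding chains_tot_complex_iff using a(1) by (simp add: z_def)
  moreover have "aug_map Tot z = q"
    by (simp add: aug_tot_complex z_def a(2) \<alpha>(2) cong: sum.cong_simp)
  ultimately show "q \<in> aug_map Tot ` chains B Tot 0" by blast
qed

lemma graded_free_resolution_tot_complex:
  "graded_free_resolution B Tot {q. \<exists>\<alpha>. (\<forall>i\<le>m. \<alpha> i \<in> I i) \<and> q = (\<Sum>i\<le>m. Var 0 ^ (m - i) * \<alpha> i)}"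
  unfolding graded_free_resolution_iff
proof (intro conjI allI)
  show "bdry_map Tot (Suc 0) ` chains B Tot (Suc 0) = {v \<in> chains B Tot 0. aug_map Tot v = 0}"
  proof (intro equalityI subsetI)
    fix v assume "v \<in> bdry_map Tot (Suc 0) ` chains B Tot (Suc 0)"
    then show "v \<in> {v \<in> chains B Tot 0. aug_map Tot v = 0}"
      using aug_bdry_tot_complex bdry_map_in_chains[OF tot_complex_graded_free, of _ 0] by blast
  qed (use exact_tot_complex_0 in blast)
  show "bdry_map Tot (Suc (Suc j)) ` chains B Tot (Suc (Suc j)) =
      {v \<in> chains B Tot (Suc j). bdry_map Tot (Suc j) v = (\<lambda>_. 0)}" for j
  proof (intro equalityI subsetI)
    fix v assume "v \<in> bdry_map Tot (Suc (Suc j)) ` chains B Tot (Suc (Suc j))"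
    then show "v \<in> {v \<in> chains B Tot (Suc j). bdry_map Tot (Suc j) v = (\<lambda>_. 0)}"
      using bdry_bdry_tot_complex bdry_map_in_chains[OF tot_complex_graded_free, of _ "Suc j"] by blast
  qed (use exact_tot_complex_Suc in blast)
qed (rule tot_complex_graded_free aug_image_tot_complex)+

end

end


section \<open>Ideals of fat points in the hyperplane\<close>

lemma ideals_set_simps [simp]:
  "carrier (ideals_set R) = {I. ideal I R}" "one (ideals_set R) = carrier R" "monoid.mult (ideals_set R) = ideal_prod R"
  by (simp_all add: ideals_set_def)

lemma ideal_power_0: "I [^]\<^bsub>ideals_set (poly_ring A)\<^esub> (0::nat) = polys A"
  by simp

lemma ideal_power_Suc:
  "I [^]\<^bsub>ideals_set (poly_ring A)\<^esub> Suc n =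
    ideal_prod (poly_ring A) (I [^]\<^bsub>ideals_set (poly_ring A)\<^esub> n) I"
  by simp

lemma ideal_power_1:
  assumes "ideal I (poly_ring A :: 'k::comm_ring_1 mpoly ring)"
  shows "I [^]\<^bsub>ideals_set (poly_ring A)\<^esub> (1::nat) = I"
proof -
  interpret cring "poly_ring A :: 'k mpoly ring" by (rule cring_poly_ring)
  interpret M: comm_monoid "ideals_set (poly_ring A :: 'k mpoly ring)" by (rule ideals_set_is_comm_monoid)
  show ?thesis
    using M.l_one[of I] assms by simp
qed

lemma ideal_power_ideal:
  assumes "ideal I (poly_ring A :: 'k::comm_ring_1 mpoly ring)"
  shows "ideal (I [^]\<^bsub>ideals_set (poly_ring A)\<^esub> (n::nat)) (poly_ring A)"
proof -
  interpret cring "poly_ring A :: 'k mpoly ring" by (rule cring_poly_ring)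
  interpret M: comm_monoid "ideals_set (poly_ring A :: 'k mpoly ring)" by (rule ideals_set_is_comm_monoid)
  show ?thesis
    using M.nat_pow_closed[of I n] assms by simp
qed

lemma ideal_power_antimono:
  assumes "ideal I (poly_ring A :: 'k::comm_ring_1 mpoly ring)" "n \<le> n'"
  shows "I [^]\<^bsub>ideals_set (poly_ring A)\<^esub> n' \<subseteq> I [^]\<^bsub>ideals_set (poly_ring A)\<^esub> (n::nat)"
proof -
  interpret cring "poly_ring A :: 'k mpoly ring" by (rule cring_poly_ring)
  show ?thesis
    using \<open>n \<le> n'\<close>
  proof (induction rule: dec_induct)
    case (step n')
    then show ?case
      using ideal_prod_inter[OF ideal_power_ideal[OF assms(1)] assms(1), of n']
      by (auto simp: ideal_power_Suc)
  qed simp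
qed

lemma point_ideal_ideal: "ideal (point_ideal A P) (poly_ring A :: 'k::field mpoly ring)"
proof -
  interpret cring "poly_ring A :: 'k mpoly ring" by (rule cring_poly_ring)
  show ?thesis
    unfolding point_ideal_def by (rule genideal_ideal) auto
qed

lemma form_in_point_ideal:
  assumes "q \<in> polys A" "homog n q" "\<And>v. v \<in> P \<Longrightarrow> mpoly_eval v q = 0"
  shows "q \<in> point_ideal A (P :: (nat \<Rightarrow> 'k::field) set)"
proof -
  interpret cring "poly_ring A :: 'k mpoly ring" by (rule cring_poly_ring)
  show ?thesis
    unfolding point_ideal_def using assms by (intro subsetD[OF genideal_self]) auto
qed

lemma point_ideal_minimal:
  assumes "ideal I (poly_ring A :: 'k::field mpoly ring)"
    and "\<And>q n. q \<in> polys A \<Longrightarrow> homog n q \<Longrightarrow> (\<And>v. v \<in> P \<Longrightarrow> mpoly_eval v q = 0) \<Longrightarrow> q \<in> I"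
  shows "point_ideal A P \<subseteq> I"
proof -
  interpret cring "poly_ring A :: 'k mpoly ring" by (rule cring_poly_ring)
  show ?thesis
    unfolding point_ideal_def using assms by (intro genideal_minimal) auto
qed

lemma mpoly_eval_Var: "mpoly_eval v (Var i) = v i"
  by (simp add: mpoly_eval_def Var_def)

abbreviation point_ideal_power :: "nat set \<Rightarrow> (nat \<Rightarrow> 'k::field) set \<Rightarrow> nat \<Rightarrow> 'k mpoly set"
  where "point_ideal_power A P n \<equiv> point_ideal A P [^]\<^bsub>ideals_set (poly_ring A)\<^esub> n"

lemma x0_graded_point_ideal_power:
  assumes "0 \<notin> A"
  shows "ideal (x0_graded A (\<lambda>k. point_ideal_power A P (n - k)))
    (poly_ring (insert 0 A) :: 'k::field mpoly ring)"
  by (intro x0_graded_ideal ideal_power_ideal ideal_power_antimono point_ideal_ideal assms) simp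

text \<open>Modulo \<open>x\<^sub>0\<close>, which vanishes at the point, a polynomial is its coefficient of \<open>x\<^sub>0\<^sup>0\<close>, and that
  coefficient has the same values on the hyperplane.  The exponent \<open>1 - k\<close> imposes the condition
  for \<open>k = 0\<close> only; the right hand side is written in the form in which
  the induction for the powers uses it.\<close>

lemma point_ideal_insert_0:
  fixes P :: "(nat \<Rightarrow> 'k::field) set"
  assumes "0 \<notin> A" and P: "\<And>v. v \<in> P \<Longrightarrow> v 0 = 0"
  shows "point_ideal (insert 0 A) P = x0_graded A (\<lambda>k. point_ideal_power A P (1 - k))"
proof (intro equalityI subsetI)
  have *: "x0_coeff k q \<in> point_ideal_power A P (1 - k) \<longleftrightarrow> k \<noteq> 0 \<or> x0_coeff 0 q \<in> point_ideal A P"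
    if "q \<in> polys (insert 0 A)" for k and q :: "'k mpoly"
    using x0_coeff_in_polys[OF that, of k] \<open>0 \<notin> A\<close> ideal_power_1[OF point_ideal_ideal[of A P]]
    by (cases k) (auto simp: ideal_power_0)
  have "point_ideal (insert 0 A) P \<subseteq> x0_graded A (\<lambda>k. point_ideal_power A P (1 - k))"
  proof (rule point_ideal_minimal[OF x0_graded_point_ideal_power[OF \<open>0 \<notin> A\<close>]])
    fix q :: "'k mpoly" and n
    assume q: "q \<in> polys (insert 0 A)" "homog n q" "\<And>v. v \<in> P \<Longrightarrow> mpoly_eval v q = 0"
    have "x0_coeff 0 q \<in> point_ideal A P"
      using q x0_coeff_in_polys[OF q(1), of 0] \<open>0 \<notin> A\<close> P
      by (intro form_in_point_ideal[of _ _ n]) (auto simp: homog_x0_coeff x0_coeff_eval)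
    then show "q \<in> x0_graded A (\<lambda>k. point_ideal_power A P (1 - k))"
      using q(1) * by (auto simp: x0_graded_def)
  qed
  then show "q \<in> x0_graded A (\<lambda>k. point_ideal_power A P (1 - k))" if "q \<in> point_ideal (insert 0 A) P" for q
    using that by blast
  fix q assume "q \<in> x0_graded A (\<lambda>k. point_ideal_power A P (1 - k))"
  then have q: "q \<in> polys (insert 0 A)" and q0: "x0_coeff 0 q \<in> point_ideal A P"
    using * by (auto simp: x0_graded_def)
  note I = point_ideal_ideal[of "insert 0 A" P]
  have "point_ideal A P \<subseteq> polys A \<inter> point_ideal (insert 0 A) P"
  proof (rule point_ideal_minimal[OF poly_ring_idealI])
    fix q n assume "q \<in> polys A" "homog n q" "\<And>v. v \<in> P \<Longrightarrow> mpoly_eval v q = 0"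
    then show "q \<in> polys A \<inter> point_ideal (insert 0 A) P"
      using polys_mono[of A "insert 0 A"] by (auto intro: form_in_point_ideal)
  qed (use polys_mono[of A "insert 0 A"] in
      \<open>auto simp: polys_closed intro: ideal_zero[OF I] ideal_add[OF I] ideal_mult[OF I]\<close>)
  with q0 have "x0_coeff 0 q \<in> point_ideal (insert 0 A) P" by blast
  moreover obtain s where s: "s \<in> polys (insert 0 A)" "q = x0_coeff 0 q + Var 0 * s"
    by (rule x0_split[OF q])
  moreover have "Var 0 \<in> point_ideal (insert 0 A) P"
    using P by (intro form_in_point_ideal[of _ _ 1]) (auto simp: Var_in_polys homog_Var mpoly_eval_Var)
  then have "Var 0 * s \<in> point_ideal (insert 0 A) P"
    using ideal_mult[OF I _ s(1), of "Var 0"] by (simp add: mult.commute)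
  ultimately show "q \<in> point_ideal (insert 0 A) P"
    using ideal_add[OF I] by metis
qed

text \<open>The induction step is \<open>T\<^sub>n T\<^sub>1 = T\<^sub>n\<^sub>+\<^sub>1\<close>, where \<open>T\<^sub>n\<close> is the direct sum of the
  \<open>x\<^sub>0\<^sup>k J\<^bsup>(n-k)+\<^esup>\<close>.  For \<open>k \<le> n\<close> the summand of \<open>T\<^sub>n\<^sub>+\<^sub>1\<close> at \<open>k\<close> is
  \<open>x\<^sub>0\<^sup>k J\<^bsup>n-k\<^esup> \<cdot> J\<close>, and for \<open>k > n\<close> a factor \<open>x\<^sub>0\<close>, which lies in \<open>T\<^sub>1\<close>, splits off.\<close>

lemma point_ideal_power_insert_0:
  fixes P :: "(nat \<Rightarrow> 'k::field) set"
  assumes "0 \<notin> A" and P: "\<And>v. v \<in> P \<Longrightarrow> v 0 = 0"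
  shows "point_ideal_power (insert 0 A) P n = x0_graded A (\<lambda>k. point_ideal_power A P (n - k))"
proof (induction n)
  case 0
  show ?case
    using x0_coeff_in_polys[of _ A] \<open>0 \<notin> A\<close> by (auto simp: ideal_power_0 x0_graded_def)
next
  case (Suc n)
  interpret cring "poly_ring (insert 0 A) :: 'k mpoly ring" by (rule cring_poly_ring)
  let ?J = "point_ideal_power A P"
  let ?T = "\<lambda>n. x0_graded A (\<lambda>k. ?J (n - k))"
  note T = x0_graded_point_ideal_power[OF \<open>0 \<notin> A\<close>, of P]
  note J = ideal_power_ideal[OF point_ideal_ideal[of A P]]
  have coeff: "x0_coeff k q \<in> polys A" if "q \<in> polys (insert 0 A)" for k and q :: "'k mpoly"
    using x0_coeff_in_polys[OF that, of k] \<open>0 \<notin> A\<close> by simp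
  let ?X = "ideal_prod (poly_ring (insert 0 A)) (?T n) (?T 1)"
  have X: "ideal ?X (poly_ring (insert 0 A))"
    by (rule ideal_prod_is_ideal[OF T T])
  have "q \<in> ?T (Suc n)" if "q \<in> ?X" for q
    using that
  proof (induction rule: ideal_prod.induct)
    case (prod u s)
    have u: "u \<in> polys (insert 0 A)" "\<And>k. x0_coeff k u \<in> ?J (n - k)"
      and s: "s \<in> polys (insert 0 A)" "x0_coeff 0 s \<in> ?J 1"
      using prod by (auto simp: x0_graded_def dest: spec[of _ 0])
    obtain s' where s': "s' \<in> polys (insert 0 A)" "s = x0_coeff 0 s + Var 0 * s'"
      by (rule x0_split[OF s(1)])
    have "s' * u \<in> ?T n"
      by (rule ideal_mult[OF T prod(1) s'(1)])
    then have s'u: "\<And>k. x0_coeff k (s' * u) \<in> ?J (n - k)"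
      by (simp add: x0_graded_def)
    have "x0_coeff k (u * s) \<in> ?J (Suc n - k)" for k
    proof -
      have "u * s = x0_coeff 0 s * u + Var 0 ^ 1 * (s' * u)"
        by (subst s'(2)) (simp add: algebra_simps)
      then have eq: "x0_coeff k (u * s) = x0_coeff 0 s * x0_coeff k u +
          (if 1 \<le> k then x0_coeff (k - 1) (s' * u) else 0)"
        by (simp only: x0_coeff_add x0_coeff_mult[OF coeff[OF s(1)] \<open>0 \<notin> A\<close>] x0_coeff_Var_0_power_mult)
      have "x0_coeff 0 s * x0_coeff k u \<in> ?J (Suc n - k)"
      proof (cases "k \<le> n")
        case True
        have "x0_coeff k u * x0_coeff 0 s \<in> ideal_prod (poly_ring A) (?J (n - k)) (point_ideal A P)"
          using ideal_prod.prod[of "x0_coeff k u" "?J (n - k)" "x0_coeff 0 s" "point_ideal A P" "poly_ring A"]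
            u(2)[of k] s(2) ideal_power_1[OF point_ideal_ideal[of A P]] by simp
        then show ?thesis
          using True by (simp add: Suc_diff_le ideal_power_Suc mult.commute)
      next
        case False
        then show ?thesis
          using coeff[OF s(1), of 0] coeff[OF u(1), of k] by (simp add: ideal_power_0 mult_in_polys)
      qed
      moreover have "(if 1 \<le> k then x0_coeff (k - 1) (s' * u) else 0) \<in> ?J (Suc n - k)"
      proof (cases "1 \<le> k")
        case True
        then have "Suc n - k = n - (k - 1)" by simp
        with True show ?thesis
          using s'u[of "k - 1"] by (simp only: if_True)
      next
        case False
        then show ?thesis
          by (simp only: if_False ideal_zero[OF J])
      qed
      ultimately show ?thesis
        unfolding eq by (rule ideal_add[OF J])
    qed
    then show ?case
      using u(1) s(1) by (simp add: x0_graded_def mult_in_polys)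
  next
    case (sum s1 s2)
    then show ?case
      using ideal_add[OF T] by simp
  qed
  moreover have "q \<in> ?X" if q: "q \<in> ?T (Suc n)" for q
  proof -
    have "Var 0 ^ k * x0_coeff k q \<in> ?X" for k
    proof (cases "k \<le> n")
      case True
      have "x0_coeff k q \<in> ?J (Suc n - k)"
        using q by (simp add: x0_graded_def)
      then have "x0_coeff k q \<in> ideal_prod (poly_ring A) (?J (n - k)) (point_ideal A P)"
        using True by (simp add: Suc_diff_le ideal_power_Suc)
      then show ?thesis
      proof (induction rule: ideal_prod.induct)
        case (prod u s)
        have "Var 0 ^ k * u \<in> ?T n"
          using prod(1) \<open>0 \<notin> A\<close> ideal_zero[OF J] ideal_subset_polys[OF J]
          by (intro Var_0_power_mult_in_x0_graded) auto
        moreover have "Var 0 ^ 0 * s \<in> ?T 1"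
          using prod(2) \<open>0 \<notin> A\<close> ideal_zero[OF J] ideal_subset_polys[OF point_ideal_ideal, of A P]
            ideal_power_1[OF point_ideal_ideal[of A P]]
          by (intro Var_0_power_mult_in_x0_graded) auto
        ultimately have "(Var 0 ^ k * u) * (Var 0 ^ 0 * s) \<in> ?X"
          using ideal_prod.prod[of _ "?T n" _ "?T 1" "poly_ring (insert 0 A)"] by simp
        then show ?case
          by (simp add: mult.assoc)
      next
        case (sum s1 s2)
        then show ?case
          using ideal_add[OF X] by (simp add: distrib_left)
      qed
    next
      case False
      then obtain k' where k: "k = Suc k'" "n \<le> k'"
        by (cases k) auto
      have "Var 0 ^ k' * x0_coeff k q \<in> ?T n"
        using k \<open>0 \<notin> A\<close> ideal_zero[OF J] coeff[of q k] q
        by (intro Var_0_power_mult_in_x0_graded) (auto simp: ideal_power_0 x0_graded_def)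
      moreover have "Var 0 ^ 1 * 1 \<in> ?T 1"
        using \<open>0 \<notin> A\<close> ideal_zero[OF J]
        by (intro Var_0_power_mult_in_x0_graded) (auto simp: ideal_power_0 one_in_polys)
      ultimately have "(Var 0 ^ k' * x0_coeff k q) * (Var 0 ^ 1 * 1) \<in> ?X"
        using ideal_prod.prod[of _ "?T n" _ "?T 1" "poly_ring (insert 0 A)"] by simp
      then show ?thesis
        by (simp add: k(1) mult_ac)
    qed
    then have mem: "(\<Sum>k<N. Var 0 ^ k * x0_coeff k q) \<in> ?X" for N
      by (intro ideal_sum[OF X])
    obtain N where "\<forall>M\<ge>N. q = (\<Sum>k<M. Var 0 ^ k * x0_coeff k q)"
      using x0_expansion by blast
    from this[rule_format, OF order_refl] mem[of N] show ?thesis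
      by (rule ssubst[where P = "\<lambda>s. s \<in> ?X"])
  qed
  ultimately have X_eq: "?X = ?T (Suc n)" by blast
  have base: "point_ideal (insert 0 A) P = ?T 1"
    by (rule point_ideal_insert_0[OF \<open>0 \<notin> A\<close>]) (rule P)
  show ?case
    unfolding ideal_power_Suc[where A = "insert 0 A"] Suc.IH by (subst base) (rule X_eq)
qed

lemma fat_ideal_insert_0:
  fixes p :: "nat \<Rightarrow> (nat \<Rightarrow> 'k::field) set"
  assumes "0 \<notin> A" and p: "\<And>j v. j \<in> {1..r} \<Longrightarrow> v \<in> p j \<Longrightarrow> v 0 = 0"
  shows "fat_ideal (insert 0 A) r p a = x0_graded A (\<lambda>k. fat_ideal A r p (\<lambda>j. a j - k))"
proof -
  have "point_ideal_power (insert 0 A) (p j) (a j) = x0_graded A (\<lambda>k. point_ideal_power A (p j) (a j - k))"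
    if "j \<in> {1..r}" for j
    using p[OF that] by (intro point_ideal_power_insert_0 \<open>0 \<notin> A\<close>)
  then show ?thesis
    using x0_coeff_in_polys[of _ A] \<open>0 \<notin> A\<close> unfolding fat_ideal_def by (auto simp: x0_graded_def)
qed

lemma fat_ideal_ideal: "ideal (fat_ideal A r p a) (poly_ring A :: 'k::field mpoly ring)"
proof (rule poly_ring_idealI)
  note J = ideal_power_ideal[OF point_ideal_ideal]
  show "fat_ideal A r p a \<subseteq> polys A" "0 \<in> fat_ideal A r p a"
    by (auto simp: fat_ideal_def polys_closed ideal_zero[OF J])
  show "q + s \<in> fat_ideal A r p a" if "q \<in> fat_ideal A r p a" "s \<in> fat_ideal A r p a" for q s
    using that by (auto simp: fat_ideal_def polys_closed ideal_add[OF J])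
  show "s * q \<in> fat_ideal A r p a" if "q \<in> fat_ideal A r p a" "s \<in> polys A" for q s
    using that by (auto simp: fat_ideal_def polys_closed ideal_mult[OF J])
qed

lemma fat_ideal_antimono:
  fixes p :: "nat \<Rightarrow> (nat \<Rightarrow> 'k::field) set"
  assumes "\<And>j. j \<in> {1..r} \<Longrightarrow> b j \<le> a j"
  shows "fat_ideal A r p a \<subseteq> fat_ideal A r p b"
  unfolding fat_ideal_def
  using ideal_power_antimono[OF point_ideal_ideal assms] by blast


section \<open>The resolution of the ideal of \<open>Z'\<close>\<close>

theorem lemma2p4:
  fixes d r m :: nat
    and p :: "nat \<Rightarrow> (nat \<Rightarrow> 'k::alg_closed_field) set"
    and mu :: "nat \<Rightarrow> nat"
    and F :: "nat \<Rightarrow> ('g, 'k mpoly) gcomplex"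
    and f :: "nat \<Rightarrow> nat \<Rightarrow> 'g \<Rightarrow> 'g \<Rightarrow> 'k mpoly"
  assumes "d \<ge> 1" and "r \<ge> 1"
    and points: "\<forall>j\<in>{1..r}. p j \<in> proj_space {1..d}"
    and m: "m = Max (mu ` {1..r})"
    \<comment> \<open>subtraction on \<open>nat\<close> truncates, so \<open>mu j + i - m\<close> is the positive part\<close>
    and F: "\<forall>i\<le>m. minimal_graded_free_resolution {1..d} (F i)
                    (fat_ideal {1..d} r p (\<lambda>j. mu j + i - m))"
    and f: "\<forall>i<m. lifts_inclusion {1..d} (F (Suc i)) (F i) (f (Suc i))"
  shows "graded_free_resolution {0..d} (tot_complex m F f) (fat_ideal {0..d} r p mu)"
proof -
  let ?A = "{1..d}"
  define J where "J k = fat_ideal ?A r p (\<lambda>j. mu j - k)" for k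
  have A: "0 \<notin> ?A" "{0..d} = insert 0 ?A" by auto
  have J_ideal: "\<And>k. ideal (J k) (poly_ring ?A)"
    unfolding J_def by (rule fat_ideal_ideal)
  have J_mono: "\<And>k. J k \<subseteq> J (Suc k)"
    unfolding J_def by (rule fat_ideal_antimono) simp
  have mu_le: "mu j \<le> m" if "j \<in> {1..r}" for j
    unfolding m using that by (intro Max_ge) auto
  have J_stable: "J k = J m" if "m \<le> k" for k
  proof -
    have "mu j - k = 0" "mu j - m = 0" if "j \<in> {1..r}" for j
      using mu_le[OF that] \<open>m \<le> k\<close> by simp_all
    then show ?thesis
      unfolding J_def by (intro equalityI fat_ideal_antimono) simp_all
  qed
  have res: "graded_free_resolution ?A (F i) (J (m - i))" if "i \<le> m" for i
  proof -
    have "(\<lambda>j. mu j + i - m) = (\<lambda>j. mu j - (m - i))"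
      using that by auto
    then show ?thesis
      using F that by (simp add: minimal_graded_free_resolution_def J_def)
  qed
  have "graded_free_resolution (insert 0 ?A) (tot_complex m F f)
    {q. \<exists>\<alpha>. (\<forall>i\<le>m. \<alpha> i \<in> x0_graded ?A (\<lambda>_. J (m - i))) \<and> q = (\<Sum>i\<le>m. Var 0 ^ (m - i) * \<alpha> i)}"
  proof (rule graded_free_resolution_tot_complex)
    fix i
    show "graded_free_resolution (insert 0 ?A) (F i) (x0_graded ?A (\<lambda>_. J (m - i)))" if "i \<le> m"
      using graded_free_resolution_base_change[OF res[OF that] A(1)] .
    show "lifts_inclusion (insert 0 ?A) (F (Suc i)) (F i) (f (Suc i))" if "i < m"
      using f that res[of i] res[of "Suc i"] A(1)
      by (intro lifts_inclusion_base_change) (auto simp: graded_free_resolution_def)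
    show "q \<in> x0_graded ?A (\<lambda>_. J (m - i))"
      if "q \<in> polys (insert 0 ?A)" "Var 0 * q \<in> x0_graded ?A (\<lambda>_. J (m - i))" for q
      using that by (rule x0_graded_saturated)
  qed simp
  also have "{q. \<exists>\<alpha>. (\<forall>i\<le>m. \<alpha> i \<in> x0_graded ?A (\<lambda>_. J (m - i))) \<and> q = (\<Sum>i\<le>m. Var 0 ^ (m - i) * \<alpha> i)} =
      x0_graded ?A J"
    by (rule sum_of_x0_shifts_eq_x0_graded[OF J_ideal J_mono A(1) J_stable])
  also have "x0_graded ?A J = fat_ideal (insert 0 ?A) r p mu"
    unfolding J_def
  proof (rule fat_ideal_insert_0[symmetric, OF A(1)])
    fix j v assume "j \<in> {1..r}" "v \<in> p j"
    then have "p j \<in> proj_space ?A"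
      using points by simp
    then obtain w where "(\<forall>i. i \<notin> ?A \<longrightarrow> w i = 0) \<and> (\<exists>i. w i \<noteq> 0) \<and> p j = {\<lambda>i. c * w i | c. c \<noteq> 0}"
      unfolding proj_space_def mem_Collect_eq ..
    then show "v 0 = 0"
      using \<open>v \<in> p j\<close> by auto
  qed
  finally show ?thesis
    unfolding A(2) .
qed

end
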